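(* Let $\Lambda$ be an artin algebra, let $\Phi^{op}:\mathrm{maps}(\mathrm{mod}\,\Lambda)\to\mathrm{mod}((\mathrm{mod}\,\Lambda)^{op})$ be given by $\Phi^{op}(A_1\xrightarrow{f}A_0)=\mathrm{Coker}\big((A_0,-)\xrightarrow{(f,-)}(A_1,-)\big)$, and let $\mathscr{C}\subset\mathrm{maps}(\mathrm{mod}\,\Lambda)$ be a subcategory which contains all objects of the form $(0,M,0)$ and $(M,M,1_M)$ with $M\in\mathrm{mod}\,\Lambda$. If $\Phi^{op}(\mathscr{C})$ is contravariantly finite in $\mathrm{mod}((\mathrm{mod}\,\Lambda)^{op})$, then $\mathscr{C}$ is covariantly finite in $\mathrm{maps}(\mathrm{mod}\,\Lambda)$.
   Context: $\mathrm{mod}\,\Lambda$: finitely generated left $\Lambda$-modules. $\mathrm{mod}((\mathrm{mod}\,\Lambda)^{op})$: finitely presented covariant functors from $\mathrm{mod}\,\Lambda$ to abelian groups; $(X,-)=\mathrm{Hom}_\Lambda(X,-)$. ($\Phi^{op}$ is contravariant on morphisms.) $\mathrm{maps}(\mathrm{mod}\,\Lambda)$: objects are triples $(A_1,A_0,f)$ with $f:A_1\to A_0$ a map of finitely generated $\Lambda$-modules; morphisms are commutative squares. Subcategories are full, additive (closed under finite direct sums), and closed under isomorphisms and direct summands; $\Phi^{op}(\mathscr{C})$ is the full subcategory of functors isomorphic to $\Phi^{op}(X)$ for some $X\in\mathscr{C}$. For a subcategory $\mathscr{X}$ of a category $\mathcal{B}$, a right $\mathscr{X}$-approximation of $M\in\mathcal{B}$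 is a morphism $X\to M$ with $X\in\mathscr{X}$ through which every morphism $X'\to M$ with $X'\in\mathscr{X}$ factors; left $\mathscr{X}$-approximations are defined dually. $\mathscr{X}$ is contravariantly (covariantly) finite in $\mathcal{B}$ if every object of $\mathcal{B}$ has a right (left) $\mathscr{X}$-approximation. *)

theory Defs
  imports "HOL-Algebra.Module" "HOL-Algebra.Ideal"
begin

section \<open>Artin algebras and finitely generated left modules\<close>

definition artinian_cring :: "('k, 'c) ring_scheme \<Rightarrow> bool" where
  "artinian_cring k \<longleftrightarrow> cring k \<and>
     (\<forall>I :: nat \<Rightarrow> 'k set. (\<forall>n. ideal (I n) k) \<and> (\<forall>n. I (Suc n) \<subseteq> I n)
        \<longrightarrow> (\<exists>N. \<forall>n\<ge>N. I n = I N))"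

text \<open>
  The records \<^typ>\<open>('a, 'b) module\<close> of the library are reused, but the library locale
  \<^locale>\<open>module\<close> requires a commutative ring of scalars.  The fields \<open>mult\<close> and \<open>one\<close> that
  a module record inherits from rings play no role below.
\<close>

locale left_module = R?: ring R + M?: abelian_group M
  for R :: "('a, 'c) ring_scheme" (structure) and M :: "('a, 'b, 'd) module_scheme" (structure) +
  assumes smult_closed [simp, intro]:
      "\<lbrakk>a \<in> carrier R; x \<in> carrier M\<rbrakk> \<Longrightarrow> a \<odot>\<^bsub>M\<^esub> x \<in> carrier M"
    and smult_l_distr:
      "\<lbrakk>a \<in> carrier R; b \<in> carrier R; x \<in> carrier M\<rbrakk> \<Longrightarrow>
         (a \<oplus> b) \<odot>\<^bsub>M\<^esub> x = a \<odot>\<^bsub>M\<^esub> x \<oplus>\<^bsub>M\<^esub> b \<odot>\<^bsub>M\<^esub> x"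
    and smult_r_distr:
      "\<lbrakk>a \<in> carrier R; x \<in> carrier M; y \<in> carrier M\<rbrakk> \<Longrightarrow>
         a \<odot>\<^bsub>M\<^esub> (x \<oplus>\<^bsub>M\<^esub> y) = a \<odot>\<^bsub>M\<^esub> x \<oplus>\<^bsub>M\<^esub> a \<odot>\<^bsub>M\<^esub> y"
    and smult_assoc:
      "\<lbrakk>a \<in> carrier R; b \<in> carrier R; x \<in> carrier M\<rbrakk> \<Longrightarrow>
         (a \<otimes> b) \<odot>\<^bsub>M\<^esub> x = a \<odot>\<^bsub>M\<^esub> (b \<odot>\<^bsub>M\<^esub> x)"
    and smult_one [simp]: "x \<in> carrier M \<Longrightarrow> \<one> \<odot>\<^bsub>M\<^esub> x = x"

definition fin_gen :: "('a, 'c) ring_scheme \<Rightarrow> ('a, 'b, 'd) module_scheme \<Rightarrow> bool" where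
  "fin_gen R M \<longleftrightarrow>
     (\<exists>S. finite S \<and> S \<subseteq> carrier M \<and>
        (\<forall>x \<in> carrier M. \<exists>c \<in> S \<rightarrow> carrier R. x = (\<Oplus>\<^bsub>M\<^esub>s\<in>S. c s \<odot>\<^bsub>M\<^esub> s)))"

text \<open>A ring \<open>\<Lambda>\<close> as a module over \<open>k\<close> along a ring homomorphism \<open>\<phi>\<close> from \<open>k\<close> to \<open>\<Lambda>\<close>.\<close>

definition restrict_scalars :: "('k \<Rightarrow> 'a) \<Rightarrow> ('a, 'c) ring_scheme \<Rightarrow> ('k, 'a) module" where
  "restrict_scalars \<phi> \<Lambda> =
     \<lparr>carrier = carrier \<Lambda>, mult = mult \<Lambda>, one = \<one>\<^bsub>\<Lambda>\<^esub>, zero = \<zero>\<^bsub>\<Lambda>\<^esub>, add = add \<Lambda>,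
      smult = (\<lambda>a x. \<phi> a \<otimes>\<^bsub>\<Lambda>\<^esub> x)\<rparr>"

definition artin_algebra ::
    "('k, 'c) ring_scheme \<Rightarrow> ('k \<Rightarrow> 'a) \<Rightarrow> ('a, 'd) ring_scheme \<Rightarrow> bool" where
  "artin_algebra k \<phi> \<Lambda> \<longleftrightarrow>
     artinian_cring k \<and> ring \<Lambda> \<and> \<phi> \<in> ring_hom k \<Lambda> \<and>
     (\<forall>a \<in> carrier k. \<forall>x \<in> carrier \<Lambda>. \<phi> a \<otimes>\<^bsub>\<Lambda>\<^esub> x = x \<otimes>\<^bsub>\<Lambda>\<^esub> \<phi> a) \<and>
     fin_gen k (restrict_scalars \<phi> \<Lambda>)"

text \<open>Homomorphisms are extensional, so that equality of arrows is equality of functions.\<close>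

definition module_hom ::
    "('a, 'c) ring_scheme \<Rightarrow> ('a, 'm, 'd) module_scheme \<Rightarrow> ('a, 'n, 'e) module_scheme \<Rightarrow> ('m \<Rightarrow> 'n) set"
  where
  "module_hom R M N =
     {f \<in> carrier M \<rightarrow>\<^sub>E carrier N.
        (\<forall>x \<in> carrier M. \<forall>y \<in> carrier M. f (x \<oplus>\<^bsub>M\<^esub> y) = f x \<oplus>\<^bsub>N\<^esub> f y) \<and>
        (\<forall>a \<in> carrier R. \<forall>x \<in> carrier M. f (a \<odot>\<^bsub>M\<^esub> x) = a \<odot>\<^bsub>N\<^esub> f x)}"


section \<open>Preadditive categories\<close>

text \<open>
  \<open>Mor \<C> X Y\<close> is the abelian group of arrows from \<open>X\<close> to \<open>Y\<close>, written with the
  (multiplicative) group records of the library, and \<open>Comp \<C> X Y Z g f\<close> is the composite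
  of \<open>f\<close> from \<open>X\<close> to \<open>Y\<close> with \<open>g\<close> from \<open>Y\<close> to \<open>Z\<close>.  Arrows do not carry their domain and
  codomain, hence the object arguments of \<open>Comp\<close>.
\<close>

record ('o, 'a) precat =
  Obj :: "'o set"
  Mor :: "'o \<Rightarrow> 'o \<Rightarrow> 'a monoid"
  Comp :: "'o \<Rightarrow> 'o \<Rightarrow> 'o \<Rightarrow> 'a \<Rightarrow> 'a \<Rightarrow> 'a"
  Idn :: "'o \<Rightarrow> 'a"

abbreviation Arr :: "('o, 'a) precat \<Rightarrow> 'o \<Rightarrow> 'o \<Rightarrow> 'a set" where
  "Arr \<C> X Y \<equiv> carrier (Mor \<C> X Y)"

locale preadditive =
  fixes \<C> :: "('o, 'a) precat"
  assumes Mor_group: "\<lbrakk>X \<in> Obj \<C>; Y \<in> Obj \<C>\<rbrakk> \<Longrightarrow> comm_group (Mor \<C> X Y)"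
    and Comp_closed: "\<lbrakk>X \<in> Obj \<C>; Y \<in> Obj \<C>; Z \<in> Obj \<C>; f \<in> Arr \<C> X Y; g \<in> Arr \<C> Y Z\<rbrakk>
      \<Longrightarrow> Comp \<C> X Y Z g f \<in> Arr \<C> X Z"
    and Idn_closed: "X \<in> Obj \<C> \<Longrightarrow> Idn \<C> X \<in> Arr \<C> X X"
    and Comp_Idn_right: "\<lbrakk>X \<in> Obj \<C>; Y \<in> Obj \<C>; f \<in> Arr \<C> X Y\<rbrakk> \<Longrightarrow> Comp \<C> X X Y f (Idn \<C> X) = f"
    and Comp_Idn_left: "\<lbrakk>X \<in> Obj \<C>; Y \<in> Obj \<C>; f \<in> Arr \<C> X Y\<rbrakk> \<Longrightarrow> Comp \<C> X Y Y (Idn \<C> Y) f = f"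
    and Comp_assoc: "\<lbrakk>W \<in> Obj \<C>; X \<in> Obj \<C>; Y \<in> Obj \<C>; Z \<in> Obj \<C>;
        f \<in> Arr \<C> W X; g \<in> Arr \<C> X Y; h \<in> Arr \<C> Y Z\<rbrakk>
      \<Longrightarrow> Comp \<C> W Y Z h (Comp \<C> W X Y g f) = Comp \<C> W X Z (Comp \<C> X Y Z h g) f"
    and Comp_distr_right: "\<lbrakk>X \<in> Obj \<C>; Y \<in> Obj \<C>; Z \<in> Obj \<C>;
        f \<in> Arr \<C> X Y; f' \<in> Arr \<C> X Y; g \<in> Arr \<C> Y Z\<rbrakk>
      \<Longrightarrow> Comp \<C> X Y Z g (f \<otimes>\<^bsub>Mor \<C> X Y\<^esub> f') = Comp \<C> X Y Z g f \<otimes>\<^bsub>Mor \<C> X Z\<^esub> Comp \<C> X Y Z g f'"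
    and Comp_distr_left: "\<lbrakk>X \<in> Obj \<C>; Y \<in> Obj \<C>; Z \<in> Obj \<C>;
        f \<in> Arr \<C> X Y; g \<in> Arr \<C> Y Z; g' \<in> Arr \<C> Y Z\<rbrakk>
      \<Longrightarrow> Comp \<C> X Y Z (g \<otimes>\<^bsub>Mor \<C> Y Z\<^esub> g') f = Comp \<C> X Y Z g f \<otimes>\<^bsub>Mor \<C> X Z\<^esub> Comp \<C> X Y Z g' f"

definition isomorphic :: "('o, 'a) precat \<Rightarrow> 'o \<Rightarrow> 'o \<Rightarrow> bool" where
  "isomorphic \<C> X Y \<longleftrightarrow> X \<in> Obj \<C> \<and> Y \<in> Obj \<C> \<and>
     (\<exists>f \<in> Arr \<C> X Y. \<exists>g \<in> Arr \<C> Y X.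
        Comp \<C> X Y X g f = Idn \<C> X \<and> Comp \<C> Y X Y f g = Idn \<C> Y)"

definition zero_object :: "('o, 'a) precat \<Rightarrow> 'o \<Rightarrow> bool" where
  "zero_object \<C> Z \<longleftrightarrow> Z \<in> Obj \<C> \<and>
     (\<forall>X \<in> Obj \<C>. (\<exists>!f. f \<in> Arr \<C> X Z) \<and> (\<exists>!f. f \<in> Arr \<C> Z X))"

text \<open>\<open>Z\<close> is a direct sum of \<open>X\<close> and \<open>Y\<close>.\<close>

definition direct_sum :: "('o, 'a) precat \<Rightarrow> 'o \<Rightarrow> 'o \<Rightarrow> 'o \<Rightarrow> bool" where
  "direct_sum \<C> X Y Z \<longleftrightarrow> X \<in> Obj \<C> \<and> Y \<in> Obj \<C> \<and> Z \<in> Obj \<C> \<and>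
     (\<exists>i \<in> Arr \<C> X Z. \<exists>j \<in> Arr \<C> Y Z. \<exists>p \<in> Arr \<C> Z X. \<exists>q \<in> Arr \<C> Z Y.
        Comp \<C> X Z X p i = Idn \<C> X \<and> Comp \<C> Y Z Y q j = Idn \<C> Y \<and>
        Comp \<C> Z X Z i p \<otimes>\<^bsub>Mor \<C> Z Z\<^esub> Comp \<C> Z Y Z j q = Idn \<C> Z)"

text \<open>
  Subcategories are full, hence given by their sets of objects.  The zero object is the
  empty direct sum.
\<close>

definition additive_subcategory :: "('o, 'a) precat \<Rightarrow> 'o set \<Rightarrow> bool" where
  "additive_subcategory \<C> \<X> \<longleftrightarrow> \<X> \<subseteq> Obj \<C> \<and>
     (\<forall>Z. zero_object \<C> Z \<longrightarrow> Z \<in> \<X>) \<and>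
     (\<forall>X Y Z. direct_sum \<C> X Y Z \<and> X \<in> \<X> \<and> Y \<in> \<X> \<longrightarrow> Z \<in> \<X>) \<and>
     (\<forall>X Y Z. direct_sum \<C> X Y Z \<and> Z \<in> \<X> \<longrightarrow> X \<in> \<X> \<and> Y \<in> \<X>) \<and>
     (\<forall>X Y. isomorphic \<C> X Y \<and> X \<in> \<X> \<longrightarrow> Y \<in> \<X>)"

definition right_approximation :: "('o, 'a) precat \<Rightarrow> 'o set \<Rightarrow> 'o \<Rightarrow> 'o \<Rightarrow> 'a \<Rightarrow> bool" where
  "right_approximation \<C> \<X> M X f \<longleftrightarrow> X \<in> \<X> \<and> f \<in> Arr \<C> X M \<and>
     (\<forall>X' \<in> \<X>. \<forall>g \<in> Arr \<C> X' M. \<exists>h \<in> Arr \<C> X' X. Comp \<C> X' X M f h = g)"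

definition left_approximation :: "('o, 'a) precat \<Rightarrow> 'o set \<Rightarrow> 'o \<Rightarrow> 'o \<Rightarrow> 'a \<Rightarrow> bool" where
  "left_approximation \<C> \<X> M X f \<longleftrightarrow> X \<in> \<X> \<and> f \<in> Arr \<C> M X \<and>
     (\<forall>X' \<in> \<X>. \<forall>g \<in> Arr \<C> M X'. \<exists>h \<in> Arr \<C> X X'. Comp \<C> M X X' h f = g)"

definition contravariantly_finite :: "('o, 'a) precat \<Rightarrow> 'o set \<Rightarrow> bool" where
  "contravariantly_finite \<C> \<X> \<longleftrightarrow> \<X> \<subseteq> Obj \<C> \<and>
     (\<forall>M \<in> Obj \<C>. \<exists>X f. right_approximation \<C> \<X> M X f)"

definition covariantly_finite :: "('o, 'a) precat \<Rightarrow> 'o set \<Rightarrow> bool" where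
  "covariantly_finite \<C> \<X> \<longleftrightarrow> \<X> \<subseteq> Obj \<C> \<and>
     (\<forall>M \<in> Obj \<C>. \<exists>X f. left_approximation \<C> \<X> M X f)"


section \<open>The category of maps\<close>

definition maps :: "('o, 'a) precat \<Rightarrow> ('o \<times> 'o \<times> 'a, 'a \<times> 'a) precat" where
  "maps \<C> =
     \<lparr>Obj = {(A1, A0, f). A1 \<in> Obj \<C> \<and> A0 \<in> Obj \<C> \<and> f \<in> Arr \<C> A1 A0},
      Mor = (\<lambda>(A1, A0, f) (B1, B0, g).
        (Mor \<C> A1 B1 \<times>\<times> Mor \<C> A0 B0)
          \<lparr>carrier := {(u1, u0). u1 \<in> Arr \<C> A1 B1 \<and> u0 \<in> Arr \<C> A0 B0 \<and>
                                Comp \<C> A1 B1 B0 g u1 = Comp \<C> A1 A0 B0 u0 f}\<rparr>),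
      Comp = (\<lambda>(A1, A0, f) (B1, B0, g) (C1, C0, h) (v1, v0) (u1, u0).
        (Comp \<C> A1 B1 C1 v1 u1, Comp \<C> A0 B0 C0 v0 u0)),
      Idn = (\<lambda>(A1, A0, f). (Idn \<C> A1, Idn \<C> A0))\<rparr>"


section \<open>Finitely presented functors to abelian groups\<close>

record ('o, 'a, 'g) ab_functor =
  fobj :: "'o \<Rightarrow> 'g monoid"
  fmap :: "'o \<Rightarrow> 'o \<Rightarrow> 'a \<Rightarrow> 'g \<Rightarrow> 'g"

definition is_ab_functor :: "('o, 'a) precat \<Rightarrow> ('o, 'a, 'g) ab_functor \<Rightarrow> bool" where
  "is_ab_functor \<C> F \<longleftrightarrow>
     (\<forall>X \<in> Obj \<C>. comm_group (fobj F X)) \<and>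
     (\<forall>X \<in> Obj \<C>. \<forall>Y \<in> Obj \<C>. \<forall>f \<in> Arr \<C> X Y. fmap F X Y f \<in> hom (fobj F X) (fobj F Y)) \<and>
     (\<forall>X \<in> Obj \<C>. \<forall>x \<in> carrier (fobj F X). fmap F X X (Idn \<C> X) x = x) \<and>
     (\<forall>X \<in> Obj \<C>. \<forall>Y \<in> Obj \<C>. \<forall>Z \<in> Obj \<C>. \<forall>f \<in> Arr \<C> X Y. \<forall>g \<in> Arr \<C> Y Z.
        \<forall>x \<in> carrier (fobj F X).
          fmap F X Z (Comp \<C> X Y Z g f) x = fmap F Y Z g (fmap F X Y f x))"

definition nat_trans ::
    "('o, 'a) precat \<Rightarrow> ('o, 'a, 'g) ab_functor \<Rightarrow> ('o, 'a, 'h) ab_functor \<Rightarrow> ('o \<Rightarrow> 'g \<Rightarrow> 'h) set"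
  where
  "nat_trans \<C> F G =
     {\<eta> \<in> (\<Pi>\<^sub>E X \<in> Obj \<C>. hom (fobj F X) (fobj G X) \<inter> extensional (carrier (fobj F X))).
        \<forall>X \<in> Obj \<C>. \<forall>Y \<in> Obj \<C>. \<forall>f \<in> Arr \<C> X Y. \<forall>x \<in> carrier (fobj F X).
          \<eta> Y (fmap F X Y f x) = fmap G X Y f (\<eta> X x)}"

text \<open>The representable functor \<open>(A, -)\<close>, and the map \<open>(f, -)\<close> from \<open>(A0, -)\<close> to \<open>(A1, -)\<close>
  induced by \<open>f\<close> from \<open>A1\<close> to \<open>A0\<close>.\<close>

definition representable :: "('o, 'a) precat \<Rightarrow> 'o \<Rightarrow> ('o, 'a, 'a) ab_functor" where
  "representable \<C> A =
     \<lparr>fobj = (\<lambda>X. Mor \<C> A X), fmap = (\<lambda>X Y g h. Comp \<C> A X Y g h)\<rparr>"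

definition representable_map :: "('o, 'a) precat \<Rightarrow> 'o \<Rightarrow> 'o \<Rightarrow> 'a \<Rightarrow> ('o \<Rightarrow> 'a \<Rightarrow> 'a)" where
  "representable_map \<C> A1 A0 f = (\<lambda>X \<in> Obj \<C>. \<lambda>h \<in> Arr \<C> A0 X. Comp \<C> A1 A0 X h f)"

text \<open>Exactness of \<open>(A0, -) \<rightarrow> (A1, -) \<rightarrow> F \<rightarrow> 0\<close> is exactness at every object.\<close>

definition finitely_presented :: "('o, 'a) precat \<Rightarrow> ('o, 'a, 'g) ab_functor \<Rightarrow> bool" where
  "finitely_presented \<C> F \<longleftrightarrow>
     (\<exists>A1 \<in> Obj \<C>. \<exists>A0 \<in> Obj \<C>.
      \<exists>\<alpha> \<in> nat_trans \<C> (representable \<C> A0) (representable \<C> A1).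
      \<exists>\<beta> \<in> nat_trans \<C> (representable \<C> A1) F.
        \<forall>X \<in> Obj \<C>. \<beta> X ` Arr \<C> A1 X = carrier (fobj F X) \<and>
                    kernel (Mor \<C> A1 X) (fobj F X) (\<beta> X) = \<alpha> X ` Arr \<C> A0 X)"

definition fp_functors :: "('o, 'a) precat \<Rightarrow> (('o, 'a, 'g) ab_functor, 'o \<Rightarrow> 'g \<Rightarrow> 'g) precat" where
  "fp_functors \<C> =
     \<lparr>Obj = {F. is_ab_functor \<C> F \<and> finitely_presented \<C> F},
      Mor = (\<lambda>F G.
        \<lparr>carrier = nat_trans \<C> F G,
         mult = (\<lambda>\<eta> \<theta>. \<lambda>X \<in> Obj \<C>. \<lambda>x \<in> carrier (fobj F X). \<eta> X x \<otimes>\<^bsub>fobj G X\<^esub> \<theta> X x),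
         one = (\<lambda>X \<in> Obj \<C>. \<lambda>x \<in> carrier (fobj F X). \<one>\<^bsub>fobj G X\<^esub>)\<rparr>),
      Comp = (\<lambda>F G H \<theta> \<eta>. \<lambda>X \<in> Obj \<C>. compose (carrier (fobj F X)) (\<theta> X) (\<eta> X)),
      Idn = (\<lambda>F. \<lambda>X \<in> Obj \<C>. \<lambda>x \<in> carrier (fobj F X). x)\<rparr>"

text \<open>
  The cokernel of a natural transformation \<open>\<eta>\<close> from \<open>F\<close> to \<open>G\<close>: its values are the quotient
  groups of \<open>G X\<close> by the image of \<open>\<eta> X\<close>, and an arrow \<open>g\<close> sends the coset of \<open>x\<close> to the coset
  of \<open>G g x\<close>.
\<close>

definition cokernel ::
    "('o, 'a, 'g) ab_functor \<Rightarrow> ('o, 'a, 'h) ab_functor \<Rightarrow> ('o \<Rightarrow> 'g \<Rightarrow> 'h) \<Rightarrow> ('o, 'a, 'h set) ab_functor"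
  where
  "cokernel F G \<eta> =
     \<lparr>fobj = (\<lambda>X. fobj G X Mod (\<eta> X ` carrier (fobj F X))),
      fmap = (\<lambda>X Y g K. \<Union>x\<in>K. (\<eta> Y ` carrier (fobj F Y)) #>\<^bsub>fobj G Y\<^esub> fmap G X Y g x)\<rparr>"

text \<open>The functor \<open>\<Phi>\<^sup>o\<^sup>p\<close> on objects, and the objects of the image of a subcategory.\<close>

definition Phi_op :: "('o, 'a) precat \<Rightarrow> 'o \<times> 'o \<times> 'a \<Rightarrow> ('o, 'a, 'a set) ab_functor" where
  "Phi_op \<C> = (\<lambda>(A1, A0, f).
     cokernel (representable \<C> A0) (representable \<C> A1) (representable_map \<C> A1 A0 f))"

definition Phi_op_image ::
    "('o, 'a) precat \<Rightarrow> ('o \<times> 'o \<times> 'a) set \<Rightarrow> ('o, 'a, 'a set) ab_functor set" where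
  "Phi_op_image \<C> \<X> = {F \<in> Obj (fp_functors \<C>). \<exists>X \<in> \<X>. isomorphic (fp_functors \<C>) F (Phi_op \<C> X)}"


section \<open>The category of finitely generated left modules\<close>

text \<open>
  The carriers of the modules are subsets of the type \<open>'m\<close>.  For this to be the category of
  all finitely generated left modules up to equivalence, \<open>'m\<close> must be large enough; by lemma
  \<open>fin_gen_module_representative\<close> below an injection of the lists over \<open>R\<close> into \<open>'m\<close> suffices.
\<close>

definition fg_mod :: "('a, 'c) ring_scheme \<Rightarrow> (('a, 'm) module, 'm \<Rightarrow> 'm) precat" where
  "fg_mod R =
     \<lparr>Obj = {M. left_module R M \<and> fin_gen R M},
      Mor = (\<lambda>M N.
        \<lparr>carrier = module_hom R M N,
         mult = (\<lambda>f g. \<lambda>x \<in> carrier M. f x \<oplus>\<^bsub>N\<^esub> g x),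
         one = (\<lambda>x \<in> carrier M. \<zero>\<^bsub>N\<^esub>)\<rparr>),
      Comp = (\<lambda>M N P g f. compose (carrier M) g f),
      Idn = (\<lambda>M. \<lambda>x \<in> carrier M. x)\<rparr>"

subsection \<open>The size of the universe\<close>

lemma (in left_module) fin_gen_inj:
  assumes "fin_gen R M"
  shows "\<exists>j. inj_on j (carrier M) \<and> j ` carrier M \<subseteq> lists (carrier R)"
proof -
  obtain S where S: "finite S" "S \<subseteq> carrier M"
    and gen: "\<And>x. x \<in> carrier M \<Longrightarrow> \<exists>c \<in> S \<rightarrow> carrier R. x = (\<Oplus>\<^bsub>M\<^esub>s\<in>S. c s \<odot>\<^bsub>M\<^esub> s)"
    using assms unfolding fin_gen_def by blast
  obtain ss where ss: "set ss = S" using S(1) finite_list by blast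
  obtain c where c: "\<And>x. x \<in> carrier M \<Longrightarrow> c x \<in> S \<rightarrow> carrier R \<and> x = (\<Oplus>\<^bsub>M\<^esub>s\<in>S. c x s \<odot>\<^bsub>M\<^esub> s)"
    using gen by metis
  define j where "j = (\<lambda>x. map (c x) ss)"
  have "inj_on j (carrier M)"
  proof (rule inj_onI)
    fix x y assume xy: "x \<in> carrier M" "y \<in> carrier M" "j x = j y"
    then have eq: "c x s = c y s" if "s \<in> S" for s
      using that ss by (auto simp: j_def)
    have "(\<Oplus>\<^bsub>M\<^esub>s\<in>S. c x s \<odot>\<^bsub>M\<^esub> s) = (\<Oplus>\<^bsub>M\<^esub>s\<in>S. c y s \<odot>\<^bsub>M\<^esub> s)"
      by (rule M.finsum_cong') (use eq c[OF xy(2)] S(2) in \<open>auto intro!: smult_closed\<close>)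
    then show "x = y" using c xy by metis
  qed
  moreover have "j ` carrier M \<subseteq> lists (carrier R)"
    using c unfolding j_def lists_eq_set ss[symmetric] by (force simp: Pi_iff)
  ultimately show ?thesis by blast
qed

lemma transport_module:
  fixes M :: "('a, 'n) module" and f :: "'n \<Rightarrow> 'm"
  assumes M: "left_module R M" and fg: "fin_gen R M"
    and inj: "inj_on f (carrier M)"
  shows "\<exists>N :: ('a, 'm) module. left_module R N \<and> fin_gen R N \<and>
     (\<exists>h \<in> module_hom R M N. bij_betw h (carrier M) (carrier N))"
proof -
  interpret M: left_module R M by (rule M)
  define g where "g = the_inv_into (carrier M) f"
  have gf: "g (f x) = x" if "x \<in> carrier M" for x
    using that inj by (simp add: g_def the_inv_into_f_f)
  define N :: "('a, 'm) module" where "N =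
    \<lparr>carrier = f ` carrier M, mult = undefined, one = undefined, zero = f \<zero>\<^bsub>M\<^esub>,
      add = (\<lambda>x y. f (g x \<oplus>\<^bsub>M\<^esub> g y)), smult = (\<lambda>a x. f (a \<odot>\<^bsub>M\<^esub> g x))\<rparr>"
  have N: "carrier N = f ` carrier M" "\<zero>\<^bsub>N\<^esub> = f \<zero>\<^bsub>M\<^esub>"
    "\<And>x y. x \<oplus>\<^bsub>N\<^esub> y = f (g x \<oplus>\<^bsub>M\<^esub> g y)" "\<And>a x. a \<odot>\<^bsub>N\<^esub> x = f (a \<odot>\<^bsub>M\<^esub> g x)"
    by (auto simp: N_def)
  have ab: "abelian_group N"
  proof (rule abelian_groupI, goal_cases)
    case (6 x)
    then obtain u where u: "u \<in> carrier M" "x = f u" by (auto simp: N)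
    show ?case by (rule bexI[of _ "f (\<ominus>\<^bsub>M\<^esub> u)"]) (use u in \<open>auto simp: N gf M.l_neg\<close>)
  qed (auto simp: N gf M.a_ac)
  have mod: "left_module R N"
    by (intro left_module.intro left_module_axioms.intro M.R.ring_axioms ab)
      (auto simp: N gf M.smult_l_distr M.smult_r_distr M.smult_assoc)
  interpret N: left_module R N by (rule mod)
  have fsum: "finite S \<Longrightarrow> S \<subseteq> carrier M \<Longrightarrow> c \<in> S \<rightarrow> carrier R \<Longrightarrow>
     f (\<Oplus>\<^bsub>M\<^esub>s\<in>S. c s \<odot>\<^bsub>M\<^esub> s) = (\<Oplus>\<^bsub>N\<^esub>s\<in>f ` S. c (g s) \<odot>\<^bsub>N\<^esub> s)" for S c
  proof (induction S rule: finite_induct)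
    case empty then show ?case by (simp add: N)
  next
    case (insert s S)
    have [simp]: "s \<in> carrier M" "c s \<in> carrier R" using insert by auto
    have a: "(\<lambda>s. c s \<odot>\<^bsub>M\<^esub> s) \<in> S \<rightarrow> carrier M" using insert by auto
    have gfS: "\<And>t. t \<in> S \<Longrightarrow> g (f t) = t" using insert gf by auto
    have b: "(\<lambda>s. c (g s) \<odot>\<^bsub>N\<^esub> s) \<in> f ` S \<rightarrow> carrier N" using insert gfS
      by (auto simp: N Pi_iff)
    have IH: "f (\<Oplus>\<^bsub>M\<^esub>s\<in>S. c s \<odot>\<^bsub>M\<^esub> s) = (\<Oplus>\<^bsub>N\<^esub>s\<in>f ` S. c (g s) \<odot>\<^bsub>N\<^esub> s)"
      by (rule insert.IH) (use insert.prems in auto)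
    have n: "f s \<notin> f ` S" using insert.hyps(2) insert.prems(1) inj by (metis image_iff inj_onD insert_subset subsetD)
    have "(\<Oplus>\<^bsub>N\<^esub>s\<in>f ` insert s S. c (g s) \<odot>\<^bsub>N\<^esub> s) =
       c (g (f s)) \<odot>\<^bsub>N\<^esub> f s \<oplus>\<^bsub>N\<^esub> (\<Oplus>\<^bsub>N\<^esub>s\<in>f ` S. c (g s) \<odot>\<^bsub>N\<^esub> s)"
      unfolding image_insert using insert.hyps(1) n b
      by (subst N.finsum_insert) (auto simp: N gf)
    also have "\<dots> = f (\<Oplus>\<^bsub>M\<^esub>s\<in>insert s S. c s \<odot>\<^bsub>M\<^esub> s)"
      using insert.hyps a insert.prems unfolding IH[symmetric] by (subst M.finsum_insert) (auto simp: N gf)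
    finally show ?case by simp
  qed
  obtain S where S: "finite S" "S \<subseteq> carrier M"
    and gen: "\<And>x. x \<in> carrier M \<Longrightarrow> \<exists>c \<in> S \<rightarrow> carrier R. x = (\<Oplus>\<^bsub>M\<^esub>s\<in>S. c s \<odot>\<^bsub>M\<^esub> s)"
    using fg unfolding fin_gen_def by blast
  have "fin_gen R N"
    unfolding fin_gen_def
  proof (intro exI[of _ "f ` S"] conjI ballI)
    fix y assume "y \<in> carrier N"
    then obtain x where x: "x \<in> carrier M" "y = f x" by (auto simp: N)
    obtain c where c: "c \<in> S \<rightarrow> carrier R" "x = (\<Oplus>\<^bsub>M\<^esub>s\<in>S. c s \<odot>\<^bsub>M\<^esub> s)" using gen[OF x(1)] by blast
    show "\<exists>c\<in>f ` S \<rightarrow> carrier R. y = (\<Oplus>\<^bsub>N\<^esub>s\<in>f ` S. c s \<odot>\<^bsub>N\<^esub> s)"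
    proof (rule bexI[of _ "\<lambda>t. c (g t)"])
      show "y = (\<Oplus>\<^bsub>N\<^esub>s\<in>f ` S. c (g s) \<odot>\<^bsub>N\<^esub> s)" using fsum[OF S c(1)] c(2) x(2) by simp
      have "\<And>s. s \<in> S \<Longrightarrow> g (f s) = s" using S gf by auto
      then show "(\<lambda>t. c (g t)) \<in> f ` S \<rightarrow> carrier R" using c by (auto simp: Pi_iff)
    qed
  qed (use S in \<open>auto simp: N\<close>)
  moreover have "restrict f (carrier M) \<in> module_hom R M N"
    by (auto simp: module_hom_def N gf)
  moreover have "bij_betw (restrict f (carrier M)) (carrier M) (carrier N)"
    using inj by (auto simp: bij_betw_def N)
  ultimately show ?thesis using mod by blast
qed

lemma fin_gen_module_representative:
  fixes M :: "('a, 'n) module" and \<iota> :: "'a list \<Rightarrow> 'm"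
  assumes "left_module R M" "fin_gen R M" "inj_on \<iota> (lists (carrier R))"
  shows "\<exists>N :: ('a, 'm) module. left_module R N \<and> fin_gen R N \<and>
     (\<exists>h \<in> module_hom R M N. bij_betw h (carrier M) (carrier N))"
proof -
  obtain j where j: "inj_on j (carrier M)" "j ` carrier M \<subseteq> lists (carrier R)"
    using left_module.fin_gen_inj[OF assms(1,2)] by blast
  have "inj_on (\<iota> \<circ> j) (carrier M)"
    using j assms(3) by (meson comp_inj_on inj_on_subset)
  then show ?thesis by (rule transport_module[OF assms(1,2)])
qed


section \<open>The categories above are preadditive, and \<open>\<Phi>\<^sup>o\<^sup>p\<close> takes finitely presented values\<close>

lemma (in left_module) smult_minus:
  assumes "a \<in> carrier R" "x \<in> carrier M"
  shows "a \<odot>\<^bsub>M\<^esub> (\<ominus>\<^bsub>M\<^esub> x) = \<ominus>\<^bsub>M\<^esub> (a \<odot>\<^bsub>M\<^esub> x)"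
proof -
  have z: "a \<odot>\<^bsub>M\<^esub> \<zero>\<^bsub>M\<^esub> = \<zero>\<^bsub>M\<^esub>"
    using smult_r_distr[of a "\<zero>\<^bsub>M\<^esub>" "\<zero>\<^bsub>M\<^esub>"] assms
    by (simp add: M.add.l_cancel_one)
  show ?thesis
    by (rule sym, rule M.minus_equality) (use assms in \<open>auto simp flip: smult_r_distr simp: M.l_neg z\<close>)
qed

lemma module_homI:
  assumes "\<And>x. x \<in> carrier M \<Longrightarrow> f x \<in> carrier N"
   "\<And>x y. x \<in> carrier M \<Longrightarrow> y \<in> carrier M \<Longrightarrow> f (x \<oplus>\<^bsub>M\<^esub> y) = f x \<oplus>\<^bsub>N\<^esub> f y"
   "\<And>a x. a \<in> carrier R \<Longrightarrow> x \<in> carrier M \<Longrightarrow> f (a \<odot>\<^bsub>M\<^esub> x) = a \<odot>\<^bsub>N\<^esub> f x"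
   "\<And>x. x \<notin> carrier M \<Longrightarrow> f x = undefined"
 shows "f \<in> module_hom R M N"
  using assms by (auto simp: module_hom_def)

lemma module_homD:
  assumes "f \<in> module_hom R M N"
  shows "x \<in> carrier M \<Longrightarrow> f x \<in> carrier N"
   "x \<in> carrier M \<Longrightarrow> y \<in> carrier M \<Longrightarrow> f (x \<oplus>\<^bsub>M\<^esub> y) = f x \<oplus>\<^bsub>N\<^esub> f y"
   "a \<in> carrier R \<Longrightarrow> x \<in> carrier M \<Longrightarrow> f (a \<odot>\<^bsub>M\<^esub> x) = a \<odot>\<^bsub>N\<^esub> f x"
   "x \<notin> carrier M \<Longrightarrow> f x = undefined"
  using assms PiE_arb[of f "carrier M" "\<lambda>_. carrier N"] by (auto simp: module_hom_def)

lemma module_hom_group: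
  assumes "left_module R M" "left_module R N"
  shows "comm_group (Mor (fg_mod R) M N)"
proof -
  interpret M: left_module R M by fact
  interpret N: left_module R N by fact
  have z: "a \<odot>\<^bsub>N\<^esub> \<zero>\<^bsub>N\<^esub> = \<zero>\<^bsub>N\<^esub>" if "a \<in> carrier R" for a
    using N.smult_r_distr[of a "\<zero>\<^bsub>N\<^esub>" "\<zero>\<^bsub>N\<^esub>"] that
    by (simp add: N.M.add.l_cancel_one)
  show ?thesis
  proof (rule comm_groupI, goal_cases)
    case (1 f g)
    then have "f \<in> module_hom R M N" "g \<in> module_hom R M N" by (auto simp: fg_mod_def)
    note h = this[THEN module_homD(1)] this[THEN module_homD(2)] this[THEN module_homD(3)]
    show ?case by (auto intro!: module_homI simp: fg_mod_def h N.M.a_ac N.smult_r_distr)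
  next
    case 2 then show ?case by (auto intro!: module_homI simp: fg_mod_def z)
  next
    case (3 f g l)
    then have "f \<in> module_hom R M N" "g \<in> module_hom R M N" "l \<in> module_hom R M N" by (auto simp: fg_mod_def)
    note h = this[THEN module_homD(1)]
    show ?case by (auto simp: fg_mod_def fun_eq_iff h N.M.a_assoc)
  next
    case (4 f g)
    then have "f \<in> module_hom R M N" "g \<in> module_hom R M N" by (auto simp: fg_mod_def)
    note h = this[THEN module_homD(1)]
    show ?case by (auto simp: fg_mod_def fun_eq_iff h N.M.a_comm)
  next
    case (5 f)
    then have "f \<in> module_hom R M N" by (auto simp: fg_mod_def)
    note h = this[THEN module_homD(1)] this[THEN module_homD(4)]
    show ?case by (auto simp: fg_mod_def fun_eq_iff h)
  next
    case (6 f)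
    then have "f \<in> module_hom R M N" by (simp add: fg_mod_def)
    note h = this[THEN module_homD(1)] this[THEN module_homD(2)] this[THEN module_homD(3)]
    have "(\<lambda>x\<in>carrier M. \<ominus>\<^bsub>N\<^esub> f x) \<in> module_hom R M N"
      by (auto intro!: module_homI simp: h N.smult_minus N.M.minus_add)
    then show ?case
      by (rule_tac bexI[of _ "\<lambda>x\<in>carrier M. \<ominus>\<^bsub>N\<^esub> f x"])
         (auto simp: fg_mod_def fun_eq_iff N.M.l_neg h)
  qed
qed

lemma preadditive_fg_mod: "preadditive (fg_mod R)"
proof (rule preadditive.intro, goal_cases)
  case (1 X Y) show ?case by (rule module_hom_group) (use 1 in \<open>auto simp: fg_mod_def\<close>)
next
  case (2 X Y Z f g)
  then interpret X: left_module R X by (simp add: fg_mod_def)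
  from 2 have "f \<in> module_hom R X Y" "g \<in> module_hom R Y Z" by (auto simp: fg_mod_def)
  note h = this[THEN module_homD(1)] this[THEN module_homD(2)] this[THEN module_homD(3)]
  show ?case by (auto intro!: module_homI simp: fg_mod_def compose_def h)
next
  case (3 X)
  then interpret X: left_module R X by (simp add: fg_mod_def)
  show ?case by (auto intro!: module_homI simp: fg_mod_def)
next
  case (4 X Y f)
  then have "f \<in> module_hom R X Y" by (auto simp: fg_mod_def)
  note h = this[THEN module_homD(1)] this[THEN module_homD(4)]
  show ?case by (auto simp: fg_mod_def compose_def fun_eq_iff h)
next
  case (5 X Y f)
  then have "f \<in> module_hom R X Y" by (auto simp: fg_mod_def)
  note h = this[THEN module_homD(1)] this[THEN module_homD(4)]
  show ?case by (auto simp: fg_mod_def compose_def fun_eq_iff h)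
next
  case (6 W X Y Z f g h)
  then have "f \<in> module_hom R W X" by (auto simp: fg_mod_def)
  note h = this[THEN module_homD(1)]
  show ?case by (auto simp: fg_mod_def compose_def fun_eq_iff h)
next
  case (7 X Y Z f f' g)
  then have "f \<in> module_hom R X Y" "f' \<in> module_hom R X Y" "g \<in> module_hom R Y Z" by (auto simp: fg_mod_def)
  note h = this[THEN module_homD(1)] this[THEN module_homD(2)]
  show ?case by (auto simp: fg_mod_def compose_def fun_eq_iff h)
next
  case (8 X Y Z f g g')
  then have "f \<in> module_hom R X Y" by (auto simp: fg_mod_def)
  note h = this[THEN module_homD(1)]
  show ?case by (auto simp: fg_mod_def compose_def fun_eq_iff h)
qed

lemma nat_trans_PiE:
  "\<eta> \<in> nat_trans D F G \<Longrightarrow> X \<in> Obj D \<Longrightarrow> \<eta> X \<in> hom (fobj F X) (fobj G X) \<inter> extensional (carrier (fobj F X))"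
  unfolding nat_trans_def by (blast dest: PiE_mem)

lemma nat_transD:
  assumes "\<eta> \<in> nat_trans D F G"
  shows "\<And>X x. X \<in> Obj D \<Longrightarrow> x \<in> carrier (fobj F X) \<Longrightarrow> \<eta> X x \<in> carrier (fobj G X)"
      "\<And>X x y. X \<in> Obj D \<Longrightarrow> x \<in> carrier (fobj F X) \<Longrightarrow> y \<in> carrier (fobj F X) \<Longrightarrow> \<eta> X (x \<otimes>\<^bsub>fobj F X\<^esub> y) = \<eta> X x \<otimes>\<^bsub>fobj G X\<^esub> \<eta> X y"
      "\<And>X Y f x. X \<in> Obj D \<Longrightarrow> Y \<in> Obj D \<Longrightarrow> f \<in> Arr D X Y \<Longrightarrow> x \<in> carrier (fobj F X) \<Longrightarrow> \<eta> Y (fmap F X Y f x) = fmap G X Y f (\<eta> X x)"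
      "\<And>X x. X \<in> Obj D \<Longrightarrow> x \<notin> carrier (fobj F X) \<Longrightarrow> \<eta> X x = undefined"
      "\<And>X. X \<notin> Obj D \<Longrightarrow> \<eta> X = undefined"
  subgoal using nat_trans_PiE[OF assms] by (meson IntD1 hom_in_carrier)
  subgoal using nat_trans_PiE[OF assms] by (meson IntD1 hom_mult)
  subgoal using assms unfolding nat_trans_def by blast
  subgoal using nat_trans_PiE[OF assms] by (meson IntD2 extensional_arb)
  subgoal using assms unfolding nat_trans_def by (blast dest: PiE_arb)
  done

lemma nat_transI:
  assumes
      "\<And>X x. X \<in> Obj D \<Longrightarrow> x \<in> carrier (fobj F X) \<Longrightarrow> \<eta> X x \<in> carrier (fobj G X)"
      "\<And>X x y. X \<in> Obj D \<Longrightarrow> x \<in> carrier (fobj F X) \<Longrightarrow> y \<in> carrier (fobj F X) \<Longrightarrow> \<eta> X (x \<otimes>\<^bsub>fobj F X\<^esub> y) = \<eta> X x \<otimes>\<^bsub>fobj G X\<^esub> \<eta> X y"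
      "\<And>X Y f x. X \<in> Obj D \<Longrightarrow> Y \<in> Obj D \<Longrightarrow> f \<in> Arr D X Y \<Longrightarrow> x \<in> carrier (fobj F X) \<Longrightarrow> \<eta> Y (fmap F X Y f x) = fmap G X Y f (\<eta> X x)"
      "\<And>X x. X \<in> Obj D \<Longrightarrow> x \<notin> carrier (fobj F X) \<Longrightarrow> \<eta> X x = undefined"
      "\<And>X. X \<notin> Obj D \<Longrightarrow> \<eta> X = undefined"
    shows "\<eta> \<in> nat_trans D F G"
proof -
  have "\<eta> \<in> extensional (Obj D)" using assms(5) by (simp add: extensional_def)
  moreover have "\<eta> X \<in> hom (fobj F X) (fobj G X) \<inter> extensional (carrier (fobj F X))" if "X \<in> Obj D" for X
    using assms(1,2,4)[OF that] by (simp add: hom_def extensional_def)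
  ultimately show ?thesis unfolding nat_trans_def PiE_def using assms(3) by blast
qed

context preadditive begin

lemma Comp_one_right:
  assumes "X \<in> Obj \<C>" "Y \<in> Obj \<C>" "Z \<in> Obj \<C>" "g \<in> Arr \<C> Y Z"
  shows "Comp \<C> X Y Z g \<one>\<^bsub>Mor \<C> X Y\<^esub> = \<one>\<^bsub>Mor \<C> X Z\<^esub>"
proof -
  interpret XY: comm_group "Mor \<C> X Y" using Mor_group assms by blast
  interpret XZ: comm_group "Mor \<C> X Z" using Mor_group assms by blast
  have "Comp \<C> X Y Z g \<one>\<^bsub>Mor \<C> X Y\<^esub> \<in> Arr \<C> X Z" using assms Comp_closed by auto
  then show ?thesis
    using Comp_distr_right[of X Y Z "\<one>\<^bsub>Mor \<C> X Y\<^esub>" "\<one>\<^bsub>Mor \<C> X Y\<^esub>" g] assms by simp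
qed

lemma Comp_one_left:
  assumes "X \<in> Obj \<C>" "Y \<in> Obj \<C>" "Z \<in> Obj \<C>" "f \<in> Arr \<C> X Y"
  shows "Comp \<C> X Y Z \<one>\<^bsub>Mor \<C> Y Z\<^esub> f = \<one>\<^bsub>Mor \<C> X Z\<^esub>"
proof -
  interpret XY: comm_group "Mor \<C> Y Z" using Mor_group assms by blast
  interpret XZ: comm_group "Mor \<C> X Z" using Mor_group assms by blast
  have "Comp \<C> X Y Z \<one>\<^bsub>Mor \<C> Y Z\<^esub> f \<in> Arr \<C> X Z" using assms Comp_closed by auto
  then show ?thesis
    using Comp_distr_left[of X Y Z f "\<one>\<^bsub>Mor \<C> Y Z\<^esub>" "\<one>\<^bsub>Mor \<C> Y Z\<^esub>"] assms by simp
qed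

lemma Comp_hom_right:
  assumes "X \<in> Obj \<C>" "Y \<in> Obj \<C>" "Z \<in> Obj \<C>" "g \<in> Arr \<C> Y Z"
  shows "Comp \<C> X Y Z g \<in> hom (Mor \<C> X Y) (Mor \<C> X Z)"
  using assms Comp_closed Comp_distr_right by (auto simp: hom_def)

lemma Comp_hom_left:
  assumes "X \<in> Obj \<C>" "Y \<in> Obj \<C>" "Z \<in> Obj \<C>" "f \<in> Arr \<C> X Y"
  shows "(\<lambda>g. Comp \<C> X Y Z g f) \<in> hom (Mor \<C> Y Z) (Mor \<C> X Z)"
  using assms Comp_closed Comp_distr_left by (auto simp: hom_def)

lemma maps_group:
  assumes "X \<in> Obj (maps \<C>)" "Y \<in> Obj (maps \<C>)"
  shows "comm_group (Mor (maps \<C>) X Y)"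
proof -
  obtain A1 A0 f where X: "X = (A1, A0, f)" by (cases X)
  obtain B1 B0 g where Y: "Y = (B1, B0, g)" by (cases Y)
  have o: "A1 \<in> Obj \<C>" "A0 \<in> Obj \<C>" "f \<in> Arr \<C> A1 A0" "B1 \<in> Obj \<C>" "B0 \<in> Obj \<C>" "g \<in> Arr \<C> B1 B0"
    using assms X Y by (auto simp: maps_def)
  interpret G1: comm_group "Mor \<C> A1 B1" using Mor_group o by blast
  interpret G0: comm_group "Mor \<C> A0 B0" using Mor_group o by blast
  interpret G10: comm_group "Mor \<C> A1 B0" using Mor_group o by blast
  interpret P: group "Mor \<C> A1 B1 \<times>\<times> Mor \<C> A0 B0"
    by (rule DirProd_group) unfold_locales
  let ?H = "{(u1, u0). u1 \<in> Arr \<C> A1 B1 \<and> u0 \<in> Arr \<C> A0 B0 \<and>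
                                Comp \<C> A1 B1 B0 g u1 = Comp \<C> A1 A0 B0 u0 f}"
  interpret h1: group_hom "Mor \<C> A1 B1" "Mor \<C> A1 B0" "Comp \<C> A1 B1 B0 g"
    by unfold_locales (use Comp_hom_right o in auto)
  interpret h2: group_hom "Mor \<C> A0 B0" "Mor \<C> A1 B0" "\<lambda>u. Comp \<C> A1 A0 B0 u f"
    by unfold_locales (use Comp_hom_left o in auto)
  have "subgroup ?H (Mor \<C> A1 B1 \<times>\<times> Mor \<C> A0 B0)"
  proof (rule P.subgroupI, goal_cases)
    case 2
    have "(\<one>\<^bsub>Mor \<C> A1 B1\<^esub>, \<one>\<^bsub>Mor \<C> A0 B0\<^esub>) \<in> ?H" by (auto simp: h1.hom_one h2.hom_one)
    then show ?case by blast
  next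
    case (3 a)
    then show ?case by (auto simp: inv_DirProd[OF G1.is_group G0.is_group] h1.hom_inv h2.hom_inv)
  next
    case (4 a b)
    then show ?case by (auto simp: h1.hom_mult h2.hom_mult)
  qed auto
  then have "Group.group ((Mor \<C> A1 B1 \<times>\<times> Mor \<C> A0 B0)\<lparr>carrier := ?H\<rparr>)"
    by (rule subgroup.subgroup_is_group) (rule P.is_group)
  then show ?thesis
    by (simp add: X Y maps_def) (rule group.group_comm_groupI, auto simp: G1.m_comm G0.m_comm)
qed

lemma preadditive_maps: "preadditive (maps \<C>)"
proof (rule preadditive.intro, goal_cases)
  case (1 X Y) then show ?case by (rule maps_group)
next
  case (2 X Y Z f g) then show ?case
    apply (auto simp: maps_def Comp_closed Comp_assoc) by (metis Comp_assoc)
next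
  case (6 W X Y Z f g h) then show ?case
    by (auto simp: maps_def Comp_assoc)
qed (auto simp: maps_def Comp_closed Idn_closed Comp_Idn_left Comp_Idn_right Comp_distr_left Comp_distr_right)

context
  fixes A1 A0 f assumes o: "A1 \<in> Obj \<C>" "A0 \<in> Obj \<C>" "f \<in> Arr \<C> A1 A0"
begin

definition "precomp_image X = (\<lambda>h \<in> Arr \<C> A0 X. Comp \<C> A1 A0 X h f) ` Arr \<C> A0 X"

lemma precomp_image_subgroup: assumes "X \<in> Obj \<C>" shows "subgroup (precomp_image X) (Mor \<C> A1 X)"
proof -
  interpret h: group_hom "Mor \<C> A0 X" "Mor \<C> A1 X" "\<lambda>u. Comp \<C> A1 A0 X u f"
    using Mor_group o assms Comp_hom_left by (auto simp: group_hom_def group_hom_axioms_def comm_group_def)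
  show ?thesis unfolding precomp_image_def using h.img_is_subgroup by simp
qed

lemma Phi_fobj: "X \<in> Obj \<C> \<Longrightarrow> fobj (Phi_op \<C> (A1, A0, f)) X = Mor \<C> A1 X Mod precomp_image X"
  by (auto simp: Phi_op_def cokernel_def representable_def representable_map_def precomp_image_def)

lemma Phi_fmap:
  assumes "X \<in> Obj \<C>" "Y \<in> Obj \<C>" "g \<in> Arr \<C> X Y" "h \<in> Arr \<C> A1 X"
  shows "fmap (Phi_op \<C> (A1, A0, f)) X Y g (precomp_image X #>\<^bsub>Mor \<C> A1 X\<^esub> h) =
    precomp_image Y #>\<^bsub>Mor \<C> A1 Y\<^esub> Comp \<C> A1 X Y g h"
proof -
  interpret GX: comm_group "Mor \<C> A1 X" using Mor_group o assms by blast
  interpret GY: comm_group "Mor \<C> A1 Y" using Mor_group o assms by blast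
  have sX: "subgroup (precomp_image X) (Mor \<C> A1 X)" "subgroup (precomp_image Y) (Mor \<C> A1 Y)" using precomp_image_subgroup assms by auto
  have 1: "precomp_image Y #>\<^bsub>Mor \<C> A1 Y\<^esub> Comp \<C> A1 X Y g x = precomp_image Y #>\<^bsub>Mor \<C> A1 Y\<^esub> Comp \<C> A1 X Y g h"
    if x: "x \<in> precomp_image X #>\<^bsub>Mor \<C> A1 X\<^esub> h" for x
  proof -
    obtain u where u: "u \<in> Arr \<C> A0 X" "x = Comp \<C> A1 A0 X u f \<otimes>\<^bsub>Mor \<C> A1 X\<^esub> h"
      using x by (auto simp: precomp_image_def r_coset_def)
    have "Comp \<C> A1 X Y g x = Comp \<C> A1 X Y g (Comp \<C> A1 A0 X u f) \<otimes>\<^bsub>Mor \<C> A1 Y\<^esub> Comp \<C> A1 X Y g h"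
      using u o assms by (simp add: Comp_distr_right Comp_closed)
    also have "Comp \<C> A1 X Y g (Comp \<C> A1 A0 X u f) = Comp \<C> A1 A0 Y (Comp \<C> A0 X Y g u) f"
      using u o assms by (simp add: Comp_assoc)
    finally have "Comp \<C> A1 X Y g x \<in> precomp_image Y #>\<^bsub>Mor \<C> A1 Y\<^esub> Comp \<C> A1 X Y g h"
      using u o assms Comp_closed by (auto simp: precomp_image_def r_coset_def intro!: exI[of _ "Comp \<C> A0 X Y g u"] bexI[of _ "Comp \<C> A0 X Y g u"])
    then show ?thesis using GY.repr_independence[OF _ _ sX(2)] Comp_closed o assms by metis
  qed
  moreover have "h \<in> precomp_image X #>\<^bsub>Mor \<C> A1 X\<^esub> h" using GX.rcos_self sX assms by blast
  ultimately have "(\<Union>x\<in>precomp_image X #>\<^bsub>Mor \<C> A1 X\<^esub> h. precomp_image Y #>\<^bsub>Mor \<C> A1 Y\<^esub> Comp \<C> A1 X Y g x) = precomp_image Y #>\<^bsub>Mor \<C> A1 Y\<^esub> Comp \<C> A1 X Y g h"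
    by blast
  then show ?thesis using assms
    by (simp add: Phi_op_def cokernel_def representable_def representable_map_def precomp_image_def)
qed

lemma Phi_op_in_fp_functors: "Phi_op \<C> (A1, A0, f) \<in> Obj (fp_functors \<C>)"
proof -
  let ?F = "Phi_op \<C> (A1, A0, f)"
  have norm: "precomp_image X \<lhd> Mor \<C> A1 X" if "X \<in> Obj \<C>" for X
    using precomp_image_subgroup[OF that] comm_group.normal_iff_subgroup Mor_group o that by blast
  have Fcar: "\<And>X. X \<in> Obj \<C> \<Longrightarrow> carrier (fobj ?F X) = (\<lambda>h. precomp_image X #>\<^bsub>Mor \<C> A1 X\<^esub> h) ` Arr \<C> A1 X"
    by (simp add: Phi_fobj carrier_FactGroup)
  have Fm: "(precomp_image X #>\<^bsub>Mor \<C> A1 X\<^esub> h) \<otimes>\<^bsub>fobj ?F X\<^esub> (precomp_image X #>\<^bsub>Mor \<C> A1 X\<^esub> h') = precomp_image X #>\<^bsub>Mor \<C> A1 X\<^esub> (h \<otimes>\<^bsub>Mor \<C> A1 X\<^esub> h')"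
    if "X \<in> Obj \<C>" "h \<in> Arr \<C> A1 X" "h' \<in> Arr \<C> A1 X" for X h h'
    using that normal.rcos_sum[OF norm[OF that(1)] that(2,3)] by (simp add: Phi_fobj)
  have cl: "\<And>X h h'. X \<in> Obj \<C> \<Longrightarrow> h \<in> Arr \<C> A1 X \<Longrightarrow> h' \<in> Arr \<C> A1 X \<Longrightarrow> h \<otimes>\<^bsub>Mor \<C> A1 X\<^esub> h' \<in> Arr \<C> A1 X"
    using Mor_group o by (metis comm_groupE(1))
  have "is_ab_functor \<C> ?F"
    unfolding is_ab_functor_def
  proof (intro conjI ballI, goal_cases)
    case (1 X) then show ?case using comm_group.abelian_FactGroup[OF Mor_group[OF o(1) 1] precomp_image_subgroup[OF 1]] by (simp add: Phi_fobj)
  next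
    case (2 X Y g)
    then show ?case by (auto simp: hom_def Fcar Phi_fmap Fm cl Comp_closed o Comp_distr_right)
  next
    case (3 X x) then show ?case by (auto simp: Fcar Phi_fmap Idn_closed Comp_Idn_left o)
  next
    case (4 X Y Z u g x) then show ?case by (auto simp: Fcar Phi_fmap Comp_closed Comp_assoc o)
  qed
  moreover have "finitely_presented \<C> ?F"
    unfolding finitely_presented_def
  proof (rule bexI[OF _ o(1)], rule bexI[OF _ o(2)], rule bexI[of _ "representable_map \<C> A1 A0 f"],
      rule bexI[of _ "\<lambda>X\<in>Obj \<C>. \<lambda>h\<in>Arr \<C> A1 X. precomp_image X #>\<^bsub>Mor \<C> A1 X\<^esub> h"], intro ballI conjI, goal_cases)
    case (1 X) then show ?case by (simp add: Fcar)
  next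
    case (2 X)
    interpret GX: comm_group "Mor \<C> A1 X" using Mor_group o 2 by blast
    interpret subgroup "precomp_image X" "Mor \<C> A1 X" using precomp_image_subgroup 2 by blast
    have "precomp_image X #>\<^bsub>Mor \<C> A1 X\<^esub> h = precomp_image X \<longleftrightarrow> h \<in> precomp_image X" if "h \<in> Arr \<C> A1 X" for h
      using GX.coset_join2[OF that subgroup_axioms] GX.rcos_self[OF that subgroup_axioms] by metis
    moreover have "representable_map \<C> A1 A0 f X ` Arr \<C> A0 X = precomp_image X" using 2 by (simp add: representable_map_def precomp_image_def)
    ultimately show ?case using 2 subset by (auto simp: kernel_def Phi_fobj)
  next
    case 3
    show ?case
      by (rule nat_transI) (auto simp: representable_def Fcar Fm Phi_fmap Comp_closed o cl)
  next
    case 4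
    have cl0: "\<And>X h h'. X \<in> Obj \<C> \<Longrightarrow> h \<in> Arr \<C> A0 X \<Longrightarrow> h' \<in> Arr \<C> A0 X \<Longrightarrow> h \<otimes>\<^bsub>Mor \<C> A0 X\<^esub> h' \<in> Arr \<C> A0 X"
      using Mor_group o by (metis comm_groupE(1))
    show ?case
      by (rule nat_transI)
        (auto simp: representable_def representable_map_def Comp_closed o Comp_assoc Comp_distr_left cl0)
  qed
  ultimately show ?thesis by (simp add: fp_functors_def)
qed

end

lemma preadditive_fp_functors: "preadditive (fp_functors \<C> :: (('o, 'a, 'g) ab_functor, _) precat)"
proof -
  let ?P = "fp_functors \<C> :: (('o, 'a, 'g) ab_functor, _) precat"
  have ob: "is_ab_functor \<C> F" if "F \<in> Obj ?P" for F using that by (simp add: fp_functors_def)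
  have g: "comm_group (fobj F X)" if "F \<in> Obj ?P" "X \<in> Obj \<C>" for F X using ob[OF that(1)] that by (simp add: is_ab_functor_def)
  have fc: "fmap F X Y f x \<in> carrier (fobj F Y)" if "F \<in> Obj ?P" "X \<in> Obj \<C>" "Y \<in> Obj \<C>" "f \<in> Arr \<C> X Y" "x \<in> carrier (fobj F X)" for F X Y f x
    using ob[OF that(1)] that by (auto simp: is_ab_functor_def hom_def Pi_iff)
  have fm: "fmap F X Y f (x \<otimes>\<^bsub>fobj F X\<^esub> y) = fmap F X Y f x \<otimes>\<^bsub>fobj F Y\<^esub> fmap F X Y f y" if "F \<in> Obj ?P" "X \<in> Obj \<C>" "Y \<in> Obj \<C>" "f \<in> Arr \<C> X Y" "x \<in> carrier (fobj F X)" "y \<in> carrier (fobj F X)" for F X Y f x y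
    using ob[OF that(1)] that by (auto simp: is_ab_functor_def hom_def)
  have fh: "group_hom (fobj F X) (fobj F Y) (fmap F X Y f)" if "F \<in> Obj ?P" "X \<in> Obj \<C>" "Y \<in> Obj \<C>" "f \<in> Arr \<C> X Y" for F X Y f
    using ob[OF that(1)] that by (auto simp: is_ab_functor_def group_hom_def group_hom_axioms_def comm_group_def)
  have ops: "\<And>F G \<eta> \<theta>. \<eta> \<otimes>\<^bsub>Mor ?P F G\<^esub> \<theta> = (\<lambda>X \<in> Obj \<C>. \<lambda>x \<in> carrier (fobj F X). \<eta> X x \<otimes>\<^bsub>fobj G X\<^esub> \<theta> X x)"
    "\<And>F G. \<one>\<^bsub>Mor ?P F G\<^esub> = (\<lambda>X \<in> Obj \<C>. \<lambda>x \<in> carrier (fobj F X). \<one>\<^bsub>fobj G X\<^esub>)"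
    "\<And>F G H \<eta> \<theta>. Comp ?P F G H \<theta> \<eta> = (\<lambda>X \<in> Obj \<C>. compose (carrier (fobj F X)) (\<theta> X) (\<eta> X))"
    "\<And>F. Idn ?P F = (\<lambda>X \<in> Obj \<C>. \<lambda>x \<in> carrier (fobj F X). x)"
    by (simp_all add: fp_functors_def)
  have a: "Arr ?P F G = nat_trans \<C> F G" for F G by (simp add: fp_functors_def)
  note n = nat_transD and ni = nat_transI
  have grp: "comm_group (Mor ?P F G)" if F: "F \<in> Obj ?P" and G: "G \<in> Obj ?P" for F G
  proof (rule comm_groupI, goal_cases)
    case (1 \<eta> \<theta>)
    then have "\<eta> \<in> nat_trans \<C> F G" "\<theta> \<in> nat_trans \<C> F G" by (auto simp: a)
    note h = this[THEN n(1)] this[THEN n(2)] this[THEN n(3)]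
    show ?case unfolding a
      by (rule ni) (use fc[OF F] in \<open>auto simp: ops h fm[OF G] comm_groupE(1)[OF g[OF G]] comm_groupE(1)[OF g[OF F]]
\<close>,
       metis (no_types, lifting) g[OF G] comm_group_def comm_monoid.m_ac(1) comm_monoid.m_lcomm comm_groupE(1) h)
  next
    case 2
    show ?case unfolding a
      by (rule ni) (use fc[OF F] in \<open>auto simp: ops comm_groupE(1,2,5)[OF g[OF G]] comm_groupE(1)[OF g[OF F]] group_hom.hom_one[OF fh[OF G]]\<close>)
  next
    case (3 \<eta> \<theta> \<zeta>)
    then have "\<eta> \<in> nat_trans \<C> F G" "\<theta> \<in> nat_trans \<C> F G" "\<zeta> \<in> nat_trans \<C> F G" by (auto simp: a)
    note h = this[THEN n(1)]
    show ?case by (auto simp: fp_functors_def fun_eq_iff h comm_groupE(3)[OF g[OF G]])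
  next
    case (4 \<eta> \<theta>)
    then have "\<eta> \<in> nat_trans \<C> F G" "\<theta> \<in> nat_trans \<C> F G" by (auto simp: a)
    note h = this[THEN n(1)]
    show ?case by (auto simp: fp_functors_def fun_eq_iff h comm_groupE(4)[OF g[OF G]])
  next
    case (5 \<eta>)
    then have "\<eta> \<in> nat_trans \<C> F G" by (auto simp: a)
    note h = this[THEN n(1)] this[THEN n(4)] this[THEN n(5)]
    show ?case by (auto simp: fp_functors_def fun_eq_iff h comm_groupE(5)[OF g[OF G]] restrict_def)
  next
    case (6 \<eta>)
    then have "\<eta> \<in> nat_trans \<C> F G" by (auto simp: a)
    note h = this[THEN n(1)] this[THEN n(2)] this[THEN n(3)]
    have gg: "Group.group (fobj G X)" if "X \<in> Obj \<C>" for X using g[OF G that] by (simp add: comm_group_def)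
    have "(\<lambda>X\<in>Obj \<C>. \<lambda>x\<in>carrier (fobj F X). inv\<^bsub>fobj G X\<^esub> \<eta> X x) \<in> nat_trans \<C> F G"
      by (rule ni) (use fc[OF F] in \<open>auto simp: h comm_group.inv_mult[OF g[OF G]] group.inv_closed[OF gg] comm_groupE(1)[OF g[OF F]] group_hom.hom_inv[OF fh[OF G]]\<close>)
    then show ?case unfolding a
      by (rule_tac bexI[rotated], assumption) (auto simp: fp_functors_def fun_eq_iff h group.l_inv[OF gg])
  qed
  show ?thesis
  proof (rule preadditive.intro, goal_cases)
    case (1 X Y) then show ?case by (rule grp)
  next
    case (2 F G H \<eta> \<theta>)
    then have "\<eta> \<in> nat_trans \<C> F G" "\<theta> \<in> nat_trans \<C> G H" by (auto simp: a)
    note h = this[THEN n(1)] this[THEN n(2)] this[THEN n(3)]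
    show ?case unfolding a
      by (rule ni) (auto simp: ops compose_def h fc[OF 2(1)] comm_groupE(1)[OF g[OF 2(1)]])
  next
    case (3 F)
    show ?case unfolding a
      by (rule ni) (use 3 in \<open>auto simp: ops fc[OF 3] comm_groupE(1)[OF g[OF 3]]\<close>)
  next
    case (4 F G \<eta>)
    then have "\<eta> \<in> nat_trans \<C> F G" by (auto simp: a)
    note h = this[THEN n(1)] this[THEN n(4)] this[THEN n(5)]
    show ?case by (auto simp: fp_functors_def fun_eq_iff compose_def h restrict_def)
  next
    case (5 F G \<eta>)
    then have "\<eta> \<in> nat_trans \<C> F G" by (auto simp: a)
    note h = this[THEN n(1)] this[THEN n(4)] this[THEN n(5)]
    show ?case by (auto simp: fp_functors_def fun_eq_iff compose_def h restrict_def)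
  next
    case (6 W F G H \<eta> \<theta> \<zeta>)
    then have "\<eta> \<in> nat_trans \<C> W F" by (auto simp: a)
    note h = this[THEN n(1)]
    show ?case by (auto simp: fp_functors_def fun_eq_iff compose_def h restrict_def)
  next
    case (7 F G H \<eta> \<eta>' \<theta>)
    then have "\<eta> \<in> nat_trans \<C> F G" "\<eta>' \<in> nat_trans \<C> F G" "\<theta> \<in> nat_trans \<C> G H" by (auto simp: a)
    note h = this[THEN n(1)] this[THEN n(2)]
    show ?case by (auto simp: fp_functors_def fun_eq_iff compose_def h restrict_def)
  next
    case (8 F G H \<eta> \<theta> \<theta>')
    then have "\<eta> \<in> nat_trans \<C> F G" by (auto simp: a)
    note h = this[THEN n(1)]
    show ?case by (auto simp: fp_functors_def fun_eq_iff compose_def h restrict_def)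
  qed
qed

end

end

theory Submission
  imports Defs
begin

text \<open>
  In these comments the groups of arrows are written additively, and \<open>M\<close> stands for a map
  \<open>m : M1 \<rightarrow> M0\<close>, similarly for other letters.

  The functor \<open>\<Phi>\<^sup>o\<^sup>p\<close> is full, and an arrow \<open>(v1, v0) : M \<rightarrow> D\<close> is sent to zero exactly if \<open>v1 = s m\<close>
  for some \<open>s : M0 \<rightarrow> D1\<close>.  In that case \<open>(v1, v0) = (s m, d s) + (0, t)\<close> with \<open>t m = 0\<close>; the first
  summand factors through \<open>(m, 1)\<close> from \<open>M\<close> to the identity map of \<open>M0\<close>, and the second through
  \<open>(0, \<pi>)\<close> from \<open>M\<close> to the zero map \<open>0 \<rightarrow> Coker m\<close>.  Both of these targets lie in the subcategory,
  so what \<open>\<Phi>\<^sup>o\<^sup>p\<close> forgets is harmless for left approximations.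

  Given \<open>M\<close>, let \<open>\<eta> : \<Phi>\<^sup>o\<^sup>p(C) \<rightarrow> \<Phi>\<^sup>o\<^sup>p(M)\<close> be a right approximation with \<open>C\<close> in the subcategory, and lift
  it to \<open>u : M \<rightarrow> C\<close> (lemma \<open>Phi_full\<close>).  Every \<open>v : M \<rightarrow> D\<close> with \<open>D\<close> in the subcategory is \<open>w u\<close> plus
  an arrow that \<open>\<Phi>\<^sup>o\<^sup>p\<close> sends to zero (lemmas \<open>Phi_approximation_lift\<close> and \<open>maps_Arr_difference\<close>).
  Hence \<open>u\<close>, \<open>(m, 1)\<close> and \<open>(0, \<pi>)\<close> together form a left approximation from \<open>M\<close> to the direct sum of
  \<open>C\<close>, the identity map of \<open>M0\<close> and \<open>0 \<rightarrow> Coker m\<close>.  This argument takes place in any preadditive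
  category with direct sums and cokernels; finitely generated modules have both
  (lemmas \<open>fg_mod_direct_sum\<close> and \<open>fg_mod_cokernel\<close>).
\<close>

section \<open>Direct sums and approximations in preadditive categories\<close>

context preadditive begin

text \<open>
  The equation \<open>i p + j q = 1\<close> already forces the two mixed composites to vanish: composing it
  with \<open>q\<close> on the left gives \<open>q = (q i) p + q\<close>, so \<open>(q i) p = 0\<close>, and \<open>p i = 1\<close> yields \<open>q i = 0\<close>.
  The other one follows by exchanging the summands.
\<close>

lemma direct_sumE:
  assumes "direct_sum \<C> X Y Z"
  obtains i j p q where "X \<in> Obj \<C>" "Y \<in> Obj \<C>" "Z \<in> Obj \<C>"
    "i \<in> Arr \<C> X Z" "j \<in> Arr \<C> Y Z" "p \<in> Arr \<C> Z X" "q \<in> Arr \<C> Z Y"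
    "Comp \<C> X Z X p i = Idn \<C> X" "Comp \<C> Y Z Y q j = Idn \<C> Y"
    "Comp \<C> Z X Z i p \<otimes>\<^bsub>Mor \<C> Z Z\<^esub> Comp \<C> Z Y Z j q = Idn \<C> Z"
    "Comp \<C> X Z Y q i = \<one>\<^bsub>Mor \<C> X Y\<^esub>" "Comp \<C> Y Z X p j = \<one>\<^bsub>Mor \<C> Y X\<^esub>"
proof -
  have orth: "Comp \<C> X Z Y q i = \<one>\<^bsub>Mor \<C> X Y\<^esub>"
    if o: "X \<in> Obj \<C>" "Y \<in> Obj \<C>" "Z \<in> Obj \<C>"
      and a: "i \<in> Arr \<C> X Z" "j \<in> Arr \<C> Y Z" "p \<in> Arr \<C> Z X" "q \<in> Arr \<C> Z Y"
      and e: "Comp \<C> X Z X p i = Idn \<C> X" "Comp \<C> Y Z Y q j = Idn \<C> Y"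
        "Comp \<C> Z X Z i p \<otimes>\<^bsub>Mor \<C> Z Z\<^esub> Comp \<C> Z Y Z j q = Idn \<C> Z" for X Y i j p q
  proof -
    interpret ZY: comm_group "Mor \<C> Z Y" using Mor_group o by blast
    have c: "Comp \<C> X Z Y q i \<in> Arr \<C> X Y" "Comp \<C> Z X Y (Comp \<C> X Z Y q i) p \<in> Arr \<C> Z Y"
      using o a Comp_closed by blast+
    have "q = Comp \<C> Z Z Y q (Comp \<C> Z X Z i p \<otimes>\<^bsub>Mor \<C> Z Z\<^esub> Comp \<C> Z Y Z j q)"
      using o a by (simp add: e Comp_Idn_right)
    also have "\<dots> = Comp \<C> Z X Y (Comp \<C> X Z Y q i) p \<otimes>\<^bsub>Mor \<C> Z Y\<^esub> q"
      using o a by (simp add: Comp_distr_right Comp_closed Comp_assoc e(2) Comp_Idn_left)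
    finally have "Comp \<C> Z X Y (Comp \<C> X Z Y q i) p = \<one>\<^bsub>Mor \<C> Z Y\<^esub>"
      using c(2) a(4) ZY.r_cancel_one' by blast
    then have "Comp \<C> X Z Y (Comp \<C> Z X Y (Comp \<C> X Z Y q i) p) i = \<one>\<^bsub>Mor \<C> X Y\<^esub>"
      using Comp_one_left o a by simp
    then show ?thesis using Comp_assoc[OF o(1,3,1,2) a(1,3) c(1)] c o by (simp only: e(1) Comp_Idn_right)
  qed
  obtain i j p q where o: "X \<in> Obj \<C>" "Y \<in> Obj \<C>" "Z \<in> Obj \<C>"
      and a: "i \<in> Arr \<C> X Z" "j \<in> Arr \<C> Y Z" "p \<in> Arr \<C> Z X" "q \<in> Arr \<C> Z Y"
      and e: "Comp \<C> X Z X p i = Idn \<C> X" "Comp \<C> Y Z Y q j = Idn \<C> Y"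
        "Comp \<C> Z X Z i p \<otimes>\<^bsub>Mor \<C> Z Z\<^esub> Comp \<C> Z Y Z j q = Idn \<C> Z"
    using assms unfolding direct_sum_def by blast
  interpret ZZ: comm_group "Mor \<C> Z Z" using Mor_group o by blast
  have e': "Comp \<C> Z Y Z j q \<otimes>\<^bsub>Mor \<C> Z Z\<^esub> Comp \<C> Z X Z i p = Idn \<C> Z"
    using e(3) ZZ.m_comm Comp_closed o a by metis
  show ?thesis
    by (rule that[OF o a e orth[OF o a e] orth[OF o(2,1,3) a(2,1,4,3) e(2,1) e']])
qed

text \<open>
  The form in which direct sums are used: an arrow that is a sum of an arrow through \<open>a\<close> and an
  arrow through \<open>b\<close> factors through the single arrow \<open>e = i a + j b\<close>, by way of \<open>\<alpha> p + \<beta> q\<close>.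
\<close>

lemma direct_sum_factor:
  assumes "direct_sum \<C> X Y Z" "M \<in> Obj \<C>" "a \<in> Arr \<C> M X" "b \<in> Arr \<C> M Y"
  obtains e where "e \<in> Arr \<C> M Z"
    "\<And>D \<alpha> \<beta>. \<lbrakk>D \<in> Obj \<C>; \<alpha> \<in> Arr \<C> X D; \<beta> \<in> Arr \<C> Y D\<rbrakk> \<Longrightarrow>
      \<exists>h \<in> Arr \<C> Z D. Comp \<C> M Z D h e = Comp \<C> M X D \<alpha> a \<otimes>\<^bsub>Mor \<C> M D\<^esub> Comp \<C> M Y D \<beta> b"
proof -
  obtain i j p q where o: "X \<in> Obj \<C>" "Y \<in> Obj \<C>" "Z \<in> Obj \<C>"
      and s: "i \<in> Arr \<C> X Z" "j \<in> Arr \<C> Y Z" "p \<in> Arr \<C> Z X" "q \<in> Arr \<C> Z Y"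
      and e: "Comp \<C> X Z X p i = Idn \<C> X" "Comp \<C> Y Z Y q j = Idn \<C> Y"
         "Comp \<C> X Z Y q i = \<one>\<^bsub>Mor \<C> X Y\<^esub>" "Comp \<C> Y Z X p j = \<one>\<^bsub>Mor \<C> Y X\<^esub>"
    using direct_sumE[OF assms(1)] by metis
  note M = assms(2-4)
  note grp = Mor_group[THEN comm_group.axioms(2), THEN group.is_monoid]
  define ab where "ab = Comp \<C> M X Z i a \<otimes>\<^bsub>Mor \<C> M Z\<^esub> Comp \<C> M Y Z j b"
  have cl: "Comp \<C> M X Z i a \<in> Arr \<C> M Z" "Comp \<C> M Y Z j b \<in> Arr \<C> M Z"
    using o s M Comp_closed by auto
  have ab: "ab \<in> Arr \<C> M Z"
    unfolding ab_def using cl o M grp by (simp add: monoid.m_closed)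
  have p: "Comp \<C> M Z X p ab = a"
    unfolding ab_def using o s M cl grp
    by (simp add: Comp_distr_right Comp_assoc e Comp_Idn_left Comp_one_left monoid.r_one)
  have q: "Comp \<C> M Z Y q ab = b"
    unfolding ab_def using o s M cl grp
    by (simp add: Comp_distr_right Comp_assoc e Comp_Idn_left Comp_one_left monoid.l_one)
  show thesis
  proof (rule that[OF ab])
    fix D \<alpha> \<beta> assume D: "D \<in> Obj \<C>" "\<alpha> \<in> Arr \<C> X D" "\<beta> \<in> Arr \<C> Y D"
    let ?h = "Comp \<C> Z X D \<alpha> p \<otimes>\<^bsub>Mor \<C> Z D\<^esub> Comp \<C> Z Y D \<beta> q"
    have c: "Comp \<C> Z X D \<alpha> p \<in> Arr \<C> Z D" "Comp \<C> Z Y D \<beta> q \<in> Arr \<C> Z D"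
      using o s D Comp_closed by auto
    have "Comp \<C> M Z D ?h ab = Comp \<C> M X D \<alpha> a \<otimes>\<^bsub>Mor \<C> M D\<^esub> Comp \<C> M Y D \<beta> b"
      using c o s D M ab by (simp add: Comp_distr_left Comp_assoc[symmetric] p q)
    moreover have "?h \<in> Arr \<C> Z D" using c o D grp by (simp add: monoid.m_closed)
    ultimately show "\<exists>h \<in> Arr \<C> Z D. Comp \<C> M Z D h ab
        = Comp \<C> M X D \<alpha> a \<otimes>\<^bsub>Mor \<C> M D\<^esub> Comp \<C> M Y D \<beta> b" by blast
  qed
qed

lemma right_approximation_isomorphic:
  assumes ap: "right_approximation \<C> \<X> M X f" and M: "M \<in> Obj \<C>" and sub: "\<X> \<subseteq> Obj \<C>"
    and iso: "isomorphic \<C> X Y" and Y: "Y \<in> \<X>"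
  shows "\<exists>g. right_approximation \<C> \<X> M Y g"
proof -
  obtain a b where o: "X \<in> Obj \<C>" "Y \<in> Obj \<C>" and ab: "a \<in> Arr \<C> X Y" "b \<in> Arr \<C> Y X"
     "Comp \<C> X Y X b a = Idn \<C> X"
    using iso unfolding isomorphic_def by blast
  have f: "f \<in> Arr \<C> X M" using ap by (simp add: right_approximation_def)
  have "\<exists>h \<in> Arr \<C> X' Y. Comp \<C> X' Y M (Comp \<C> Y X M f b) h = g"
    if X': "X' \<in> \<X>" and g: "g \<in> Arr \<C> X' M" for X' g
  proof -
    obtain h where h: "h \<in> Arr \<C> X' X" "Comp \<C> X' X M f h = g"
      using ap X' g unfolding right_approximation_def by blast
    have o': "X' \<in> Obj \<C>" using X' sub by blast
    have "Comp \<C> X' Y M (Comp \<C> Y X M f b) (Comp \<C> X' X Y a h) = 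
      Comp \<C> X' X M f (Comp \<C> X' X X (Comp \<C> X Y X b a) h)"
      using o o' ab(1,2) h(1) f M by (simp add: Comp_assoc[symmetric] Comp_closed)
    also have "\<dots> = g" using o' o h ab by (simp add: Comp_Idn_left)
    finally show ?thesis using Comp_closed[OF o' o h(1) ab(1)] by blast
  qed
  moreover have "Comp \<C> Y X M f b \<in> Arr \<C> Y M" using o M ab f Comp_closed by blast
  ultimately show ?thesis using Y unfolding right_approximation_def by blast
qed

lemma maps_Obj: "(A1, A0, f) \<in> Obj (maps \<C>) \<longleftrightarrow> A1 \<in> Obj \<C> \<and> A0 \<in> Obj \<C> \<and> f \<in> Arr \<C> A1 A0"
  by (simp add: maps_def)

lemma maps_Arr: "(u1, u0) \<in> Arr (maps \<C>) (A1, A0, f) (B1, B0, g) \<longleftrightarrow>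
   u1 \<in> Arr \<C> A1 B1 \<and> u0 \<in> Arr \<C> A0 B0 \<and> Comp \<C> A1 B1 B0 g u1 = Comp \<C> A1 A0 B0 u0 f"
  by (simp add: maps_def)

lemma maps_ops:
  "Comp (maps \<C>) (A1, A0, f) (B1, B0, g) (C1, C0, h) (v1, v0) (u1, u0) =
     (Comp \<C> A1 B1 C1 v1 u1, Comp \<C> A0 B0 C0 v0 u0)"
  "Idn (maps \<C>) (A1, A0, f) = (Idn \<C> A1, Idn \<C> A0)"
  "(u1, u0) \<otimes>\<^bsub>Mor (maps \<C>) (A1, A0, f) (B1, B0, g)\<^esub> (v1, v0) =
     (u1 \<otimes>\<^bsub>Mor \<C> A1 B1\<^esub> v1, u0 \<otimes>\<^bsub>Mor \<C> A0 B0\<^esub> v0)"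
  by (simp_all add: maps_def)

text \<open>
  Direct sums of maps are formed componentwise, the structure arrow being the block-diagonal
  \<open>i0 f p1 + j0 g q1\<close>.
\<close>

lemma maps_direct_sum:
  assumes sums: "\<And>X Y. \<lbrakk>X \<in> Obj \<C>; Y \<in> Obj \<C>\<rbrakk> \<Longrightarrow> \<exists>Z. direct_sum \<C> X Y Z"
    and XY: "X \<in> Obj (maps \<C>)" "Y \<in> Obj (maps \<C>)"
  shows "\<exists>Z. direct_sum (maps \<C>) X Y Z"
proof -
  obtain A1 A0 f where X: "X = (A1, A0, f)" by (cases X)
  obtain B1 B0 g where Y: "Y = (B1, B0, g)" by (cases Y)
  have o: "A1 \<in> Obj \<C>" "A0 \<in> Obj \<C>" "f \<in> Arr \<C> A1 A0" "B1 \<in> Obj \<C>" "B0 \<in> Obj \<C>" "g \<in> Arr \<C> B1 B0"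
    using XY X Y by (auto simp: maps_Obj)
  obtain Z1 i1 j1 p1 q1 where Z1: "Z1 \<in> Obj \<C>"
    "i1 \<in> Arr \<C> A1 Z1" "j1 \<in> Arr \<C> B1 Z1" "p1 \<in> Arr \<C> Z1 A1" "q1 \<in> Arr \<C> Z1 B1"
    and e1: "Comp \<C> A1 Z1 A1 p1 i1 = Idn \<C> A1" "Comp \<C> B1 Z1 B1 q1 j1 = Idn \<C> B1"
    "Comp \<C> Z1 A1 Z1 i1 p1 \<otimes>\<^bsub>Mor \<C> Z1 Z1\<^esub> Comp \<C> Z1 B1 Z1 j1 q1 = Idn \<C> Z1"
    "Comp \<C> A1 Z1 B1 q1 i1 = \<one>\<^bsub>Mor \<C> A1 B1\<^esub>" "Comp \<C> B1 Z1 A1 p1 j1 = \<one>\<^bsub>Mor \<C> B1 A1\<^esub>"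
    using sums[OF o(1,4)] direct_sumE by metis
  obtain Z0 i0 j0 p0 q0 where Z0: "Z0 \<in> Obj \<C>"
    "i0 \<in> Arr \<C> A0 Z0" "j0 \<in> Arr \<C> B0 Z0" "p0 \<in> Arr \<C> Z0 A0" "q0 \<in> Arr \<C> Z0 B0"
    and e0: "Comp \<C> A0 Z0 A0 p0 i0 = Idn \<C> A0" "Comp \<C> B0 Z0 B0 q0 j0 = Idn \<C> B0"
    "Comp \<C> Z0 A0 Z0 i0 p0 \<otimes>\<^bsub>Mor \<C> Z0 Z0\<^esub> Comp \<C> Z0 B0 Z0 j0 q0 = Idn \<C> Z0"
    "Comp \<C> A0 Z0 B0 q0 i0 = \<one>\<^bsub>Mor \<C> A0 B0\<^esub>" "Comp \<C> B0 Z0 A0 p0 j0 = \<one>\<^bsub>Mor \<C> B0 A0\<^esub>"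
    using sums[OF o(2,5)] direct_sumE by metis
  note grp = Mor_group[THEN comm_group.axioms(2), THEN group.is_monoid]
  define fp where "fp = Comp \<C> Z1 A1 A0 f p1"
  define gq where "gq = Comp \<C> Z1 B1 B0 g q1"
  have fg: "fp \<in> Arr \<C> Z1 A0" "gq \<in> Arr \<C> Z1 B0"
    unfolding fp_def gq_def using o Z1 Comp_closed by auto
  have c: "Comp \<C> Z1 A0 Z0 i0 fp \<in> Arr \<C> Z1 Z0" "Comp \<C> Z1 B0 Z0 j0 gq \<in> Arr \<C> Z1 Z0"
    using fg o Z1 Z0 Comp_closed by auto
  have fgi: "Comp \<C> A1 Z1 A0 fp i1 = f" "Comp \<C> A1 Z1 B0 gq i1 = \<one>\<^bsub>Mor \<C> A1 B0\<^esub>"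
    "Comp \<C> B1 Z1 A0 fp j1 = \<one>\<^bsub>Mor \<C> B1 A0\<^esub>" "Comp \<C> B1 Z1 B0 gq j1 = g"
    unfolding fp_def gq_def using o Z1
    by (simp_all add: Comp_assoc[symmetric] e1 Comp_one_right Comp_Idn_right)
  define z where "z = Comp \<C> Z1 A0 Z0 i0 fp \<otimes>\<^bsub>Mor \<C> Z1 Z0\<^esub> Comp \<C> Z1 B0 Z0 j0 gq"
  have z: "z \<in> Arr \<C> Z1 Z0" unfolding z_def using c Z1 Z0 grp by (simp add: monoid.m_closed)
  have zi: "Comp \<C> A1 Z1 Z0 z i1 = Comp \<C> A1 A0 Z0 i0 f"
    and zj: "Comp \<C> B1 Z1 Z0 z j1 = Comp \<C> B1 B0 Z0 j0 g"
    unfolding z_def using o Z1 Z0 fg c grp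
    by (simp_all add: Comp_distr_left Comp_assoc[symmetric] fgi Comp_one_right monoid.r_one monoid.l_one Comp_closed)
  have pz: "Comp \<C> Z1 Z0 A0 p0 z = fp" and qz: "Comp \<C> Z1 Z0 B0 q0 z = gq"
    unfolding z_def using o Z1 Z0 fg c grp
    by (simp_all add: Comp_distr_right Comp_assoc e0 Comp_one_left Comp_Idn_left monoid.r_one monoid.l_one)
  have "direct_sum (maps \<C>) X Y (Z1, Z0, z)"
    unfolding direct_sum_def
  proof (intro conjI bexI)
    show "(i1, i0) \<in> Arr (maps \<C>) X (Z1, Z0, z)" "(j1, j0) \<in> Arr (maps \<C>) Y (Z1, Z0, z)"
      "(p1, p0) \<in> Arr (maps \<C>) (Z1, Z0, z) X" "(q1, q0) \<in> Arr (maps \<C>) (Z1, Z0, z) Y"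
      using Z1 Z0 zi zj pz qz by (simp_all add: X Y maps_Arr fp_def gq_def)
  qed (use XY Z1 Z0 z e1 e0 in \<open>simp_all add: X Y maps_Obj maps_ops\<close>)
  then show ?thesis by blast
qed

section \<open>The functor \<open>\<Phi>\<^sup>o\<^sup>p\<close> is full, and what it forgets\<close>

lemma Phi_carrier:
  assumes "A1 \<in> Obj \<C>" "A0 \<in> Obj \<C>" "f \<in> Arr \<C> A1 A0" "X \<in> Obj \<C>"
  shows "carrier (fobj (Phi_op \<C> (A1, A0, f)) X) =
    (\<lambda>h. precomp_image A1 A0 f X #>\<^bsub>Mor \<C> A1 X\<^esub> h) ` Arr \<C> A1 X"
  using assms by (simp add: Phi_fobj carrier_FactGroup)

text \<open>
  Elements of \<open>\<Phi>\<^sup>o\<^sup>p(A) X\<close> are arrows \<open>A1 \<rightarrow> X\<close> modulo those that extend along \<open>f\<close>.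
\<close>

lemma Phi_coset_eq_iff:
  assumes o: "A1 \<in> Obj \<C>" "A0 \<in> Obj \<C>" "f \<in> Arr \<C> A1 A0" "X \<in> Obj \<C>"
    and h: "h \<in> Arr \<C> A1 X" "h' \<in> Arr \<C> A1 X"
  shows "precomp_image A1 A0 f X #>\<^bsub>Mor \<C> A1 X\<^esub> h = precomp_image A1 A0 f X #>\<^bsub>Mor \<C> A1 X\<^esub> h' \<longleftrightarrow>
    (\<exists>s \<in> Arr \<C> A0 X. h = Comp \<C> A1 A0 X s f \<otimes>\<^bsub>Mor \<C> A1 X\<^esub> h')"
proof -
  interpret G: comm_group "Mor \<C> A1 X" using Mor_group o by blast
  have sg: "subgroup (precomp_image A1 A0 f X) (Mor \<C> A1 X)" using precomp_image_subgroup o by blast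
  have "(\<exists>s \<in> Arr \<C> A0 X. h = Comp \<C> A1 A0 X s f \<otimes>\<^bsub>Mor \<C> A1 X\<^esub> h') \<longleftrightarrow>
     h \<in> precomp_image A1 A0 f X #>\<^bsub>Mor \<C> A1 X\<^esub> h'"
    using o by (auto simp: r_coset_def precomp_image_def)
  also have "\<dots> \<longleftrightarrow> precomp_image A1 A0 f X #>\<^bsub>Mor \<C> A1 X\<^esub> h = precomp_image A1 A0 f X #>\<^bsub>Mor \<C> A1 X\<^esub> h'"
    using G.repr_independence[OF _ h(2) sg] G.rcos_self[OF h(1) sg] by metis
  finally show ?thesis by blast
qed


lemma Phi_mult_rcos:
  assumes o: "A1 \<in> Obj \<C>" "A0 \<in> Obj \<C>" "f \<in> Arr \<C> A1 A0" "X \<in> Obj \<C>"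
    and h: "h \<in> Arr \<C> A1 X" "h' \<in> Arr \<C> A1 X"
  shows "(precomp_image A1 A0 f X #>\<^bsub>Mor \<C> A1 X\<^esub> h)
      \<otimes>\<^bsub>fobj (Phi_op \<C> (A1, A0, f)) X\<^esub> (precomp_image A1 A0 f X #>\<^bsub>Mor \<C> A1 X\<^esub> h')
    = precomp_image A1 A0 f X #>\<^bsub>Mor \<C> A1 X\<^esub> (h \<otimes>\<^bsub>Mor \<C> A1 X\<^esub> h')"
proof -
  have "precomp_image A1 A0 f X \<lhd> Mor \<C> A1 X"
    using precomp_image_subgroup[OF o] comm_group.normal_iff_subgroup Mor_group o by blast
  then show ?thesis using h o by (simp add: Phi_fobj normal.rcos_sum)
qed

text \<open>
  The action of \<open>\<Phi>\<^sup>o\<^sup>p\<close> on arrows.  Precomposition with \<open>v1\<close> respects cosets because the square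
  turns \<open>s g v1\<close> into \<open>(s v0) f\<close>.
\<close>

lemma Phi_map:
  assumes v: "(v1, v0) \<in> Arr (maps \<C>) (A1, A0, f) (B1, B0, g)"
    and A: "(A1, A0, f) \<in> Obj (maps \<C>)" and B: "(B1, B0, g) \<in> Obj (maps \<C>)"
  obtains \<theta> where "\<theta> \<in> nat_trans \<C> (Phi_op \<C> (B1, B0, g)) (Phi_op \<C> (A1, A0, f))"
    "\<And>X h. \<lbrakk>X \<in> Obj \<C>; h \<in> Arr \<C> B1 X\<rbrakk> \<Longrightarrow> \<theta> X (precomp_image B1 B0 g X #>\<^bsub>Mor \<C> B1 X\<^esub> h)
       = precomp_image A1 A0 f X #>\<^bsub>Mor \<C> A1 X\<^esub> Comp \<C> A1 B1 X h v1"
proof -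
  let ?PA = "\<lambda>X h. precomp_image A1 A0 f X #>\<^bsub>Mor \<C> A1 X\<^esub> h"
  let ?PB = "\<lambda>X h. precomp_image B1 B0 g X #>\<^bsub>Mor \<C> B1 X\<^esub> h"
  have o: "A1 \<in> Obj \<C>" "A0 \<in> Obj \<C>" "f \<in> Arr \<C> A1 A0" "B1 \<in> Obj \<C>" "B0 \<in> Obj \<C>" "g \<in> Arr \<C> B1 B0"
    using A B by (auto simp: maps_Obj)
  have v: "v1 \<in> Arr \<C> A1 B1" "v0 \<in> Arr \<C> A0 B0" "Comp \<C> A1 B1 B0 g v1 = Comp \<C> A1 A0 B0 v0 f"
    using v by (auto simp: maps_Arr)
  note mc = Mor_group[THEN comm_groupE(1)]
  define \<theta> where "\<theta> = (\<lambda>X\<in>Obj \<C>. \<lambda>K\<in>carrier (fobj (Phi_op \<C> (B1, B0, g)) X).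
    ?PA X (Comp \<C> A1 B1 X (SOME h. h \<in> Arr \<C> B1 X \<and> K = ?PB X h) v1))"
  have wd: "?PA X (Comp \<C> A1 B1 X h v1) = ?PA X (Comp \<C> A1 B1 X h' v1)"
    if X: "X \<in> Obj \<C>" and h: "h \<in> Arr \<C> B1 X" "h' \<in> Arr \<C> B1 X" and eq: "?PB X h = ?PB X h'" for X h h'
  proof -
    obtain s where s: "s \<in> Arr \<C> B0 X" "h = Comp \<C> B1 B0 X s g \<otimes>\<^bsub>Mor \<C> B1 X\<^esub> h'"
      using Phi_coset_eq_iff[OF o(4-6) X h] eq by blast
    have "Comp \<C> A1 B1 X h v1 = Comp \<C> A1 A0 X (Comp \<C> A0 B0 X s v0) f \<otimes>\<^bsub>Mor \<C> A1 X\<^esub> Comp \<C> A1 B1 X h' v1"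
      using s o v X h by (simp add: Comp_distr_left Comp_closed Comp_assoc[symmetric])
    then show ?thesis
      using Phi_coset_eq_iff[OF o(1-3) X] Comp_closed o v s X h by blast
  qed
  have val: "\<theta> X (?PB X h) = ?PA X (Comp \<C> A1 B1 X h v1)" if X: "X \<in> Obj \<C>" and h: "h \<in> Arr \<C> B1 X" for X h
  proof -
    let ?h = "SOME h'. h' \<in> Arr \<C> B1 X \<and> ?PB X h = ?PB X h'"
    have "?h \<in> Arr \<C> B1 X \<and> ?PB X h = ?PB X ?h" by (rule someI[of _ h]) (use h in blast)
    then show ?thesis using wd[OF X h, of ?h] X h o by (simp add: \<theta>_def Phi_carrier)
  qed
  have "\<theta> \<in> nat_trans \<C> (Phi_op \<C> (B1, B0, g)) (Phi_op \<C> (A1, A0, f))"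
  proof (rule nat_transI, goal_cases)
    case (1 X x) then show ?case using o v by (auto simp: Phi_carrier val Comp_closed)
  next
    case (2 X x y) then show ?case using o v
      by (auto simp: Phi_carrier Phi_mult_rcos val Comp_closed Comp_distr_left mc)
  next
    case (3 X Y k x) then show ?case using o v
      by (auto simp: Phi_carrier Phi_fmap val Comp_closed Comp_assoc)
  qed (auto simp: \<theta>_def)
  then show thesis using val that by blast
qed

text \<open>
  \<open>\<Phi>\<^sup>o\<^sup>p\<close> is full.  By Yoneda, \<open>\<eta>\<close> is determined by the class of some \<open>u1\<close>, the image of the class
  of the identity of \<open>B1\<close>.  The class of \<open>g\<close> itself is zero, hence so is that of \<open>g u1\<close>; an
  extension of \<open>g u1\<close> along \<open>f\<close> is the missing component \<open>u0\<close>.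
\<close>

lemma Phi_full:
  assumes \<eta>: "\<eta> \<in> nat_trans \<C> (Phi_op \<C> (B1, B0, g)) (Phi_op \<C> (A1, A0, f))"
    and A: "(A1, A0, f) \<in> Obj (maps \<C>)" and B: "(B1, B0, g) \<in> Obj (maps \<C>)"
  obtains u1 u0 where "(u1, u0) \<in> Arr (maps \<C>) (A1, A0, f) (B1, B0, g)"
    "\<And>X h. \<lbrakk>X \<in> Obj \<C>; h \<in> Arr \<C> B1 X\<rbrakk> \<Longrightarrow> \<eta> X (precomp_image B1 B0 g X #>\<^bsub>Mor \<C> B1 X\<^esub> h)
       = precomp_image A1 A0 f X #>\<^bsub>Mor \<C> A1 X\<^esub> Comp \<C> A1 B1 X h u1"
proof -
  let ?PA = "\<lambda>X h. precomp_image A1 A0 f X #>\<^bsub>Mor \<C> A1 X\<^esub> h"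
  let ?PB = "\<lambda>X h. precomp_image B1 B0 g X #>\<^bsub>Mor \<C> B1 X\<^esub> h"
  have o: "A1 \<in> Obj \<C>" "A0 \<in> Obj \<C>" "f \<in> Arr \<C> A1 A0" "B1 \<in> Obj \<C>" "B0 \<in> Obj \<C>" "g \<in> Arr \<C> B1 B0"
    using A B by (auto simp: maps_Obj)
  note grp = Mor_group[THEN comm_group.axioms(2), THEN group.is_monoid]
  have id: "Idn \<C> B1 \<in> Arr \<C> B1 B1" using Idn_closed o by blast
  have "\<eta> B1 (?PB B1 (Idn \<C> B1)) \<in> carrier (fobj (Phi_op \<C> (A1, A0, f)) B1)"
    using nat_transD(1)[OF \<eta>] o id by (simp add: Phi_carrier)
  then obtain u1 where u1: "u1 \<in> Arr \<C> A1 B1" "\<eta> B1 (?PB B1 (Idn \<C> B1)) = ?PA B1 u1"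
    using o by (auto simp: Phi_carrier)
  have val: "\<eta> X (?PB X h) = ?PA X (Comp \<C> A1 B1 X h u1)" if X: "X \<in> Obj \<C>" and h: "h \<in> Arr \<C> B1 X" for X h
  proof -
    have "\<eta> X (?PB X h) = \<eta> X (fmap (Phi_op \<C> (B1, B0, g)) B1 X h (?PB B1 (Idn \<C> B1)))"
      using o X h id by (simp add: Phi_fmap Comp_Idn_right)
    also have "\<dots> = fmap (Phi_op \<C> (A1, A0, f)) B1 X h (?PA B1 u1)"
      using nat_transD(3)[OF \<eta> o(4) X h] o id u1 by (simp add: Phi_carrier)
    finally show ?thesis using o X h u1 by (simp add: Phi_fmap)
  qed
  have one: "\<one>\<^bsub>Mor \<C> B1 B0\<^esub> \<in> Arr \<C> B1 B0" using grp o monoid.one_closed by blast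
  have "g = Comp \<C> B1 B0 B0 (Idn \<C> B0) g \<otimes>\<^bsub>Mor \<C> B1 B0\<^esub> \<one>\<^bsub>Mor \<C> B1 B0\<^esub>"
    using o grp by (simp add: Comp_Idn_left monoid.r_one)
  then have "?PB B0 g = ?PB B0 \<one>\<^bsub>Mor \<C> B1 B0\<^esub>"
    using Phi_coset_eq_iff[OF o(4-6,5,6) one] Idn_closed o by blast
  then have "?PA B0 (Comp \<C> A1 B1 B0 g u1) = ?PA B0 \<one>\<^bsub>Mor \<C> A1 B0\<^esub>"
    using val[OF o(5)] o one u1 by (metis Comp_one_left)
  then obtain u0 where "u0 \<in> Arr \<C> A0 B0"
     "Comp \<C> A1 B1 B0 g u1 = Comp \<C> A1 A0 B0 u0 f \<otimes>\<^bsub>Mor \<C> A1 B0\<^esub> \<one>\<^bsub>Mor \<C> A1 B0\<^esub>"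
    using Phi_coset_eq_iff[OF o(1-3,5), of "Comp \<C> A1 B1 B0 g u1" "\<one>\<^bsub>Mor \<C> A1 B0\<^esub>"] o u1 grp
      Comp_closed monoid.one_closed by metis
  then have "u0 \<in> Arr \<C> A0 B0" "Comp \<C> A1 B1 B0 g u1 = Comp \<C> A1 A0 B0 u0 f"
    using grp o Comp_closed by (simp_all add: monoid.r_one)
  then show thesis using that[of u1 u0] val u1 by (simp add: maps_Arr)
qed

text \<open>
  An approximation by a functor merely isomorphic to \<open>\<Phi>\<^sup>o\<^sup>p(C)\<close> is replaced by one from \<open>\<Phi>\<^sup>o\<^sup>p(C)\<close>,
  where fullness can be applied.
\<close>

lemma Phi_right_approximation_in_image:
  assumes sub: "\<X> \<subseteq> Obj (maps \<C>)"
    and fin: "contravariantly_finite (fp_functors \<C>) (Phi_op_image \<C> \<X>)"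
    and M: "M \<in> Obj (maps \<C>)"
  obtains C \<eta> where "C \<in> \<X>" "right_approximation (fp_functors \<C>) (Phi_op_image \<C> \<X>) (Phi_op \<C> M) (Phi_op \<C> C) \<eta>"
proof -
  let ?P = "fp_functors \<C> :: (('o, 'a, 'a set) ab_functor, _) precat"
  interpret P: preadditive ?P by (rule preadditive_fp_functors)
  have ob: "Phi_op \<C> X \<in> Obj ?P" if "X \<in> Obj (maps \<C>)" for X
    using that Phi_op_in_fp_functors by (cases X) (auto simp: maps_Obj)
  obtain F f where F: "right_approximation ?P (Phi_op_image \<C> \<X>) (Phi_op \<C> M) F f"
    using fin ob[OF M] unfolding contravariantly_finite_def by blast
  then have "F \<in> Phi_op_image \<C> \<X>" by (simp add: right_approximation_def)
  then obtain C where C: "C \<in> \<X>" "isomorphic ?P F (Phi_op \<C> C)"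
    unfolding Phi_op_image_def by blast
  have "isomorphic ?P (Phi_op \<C> C) (Phi_op \<C> C)"
    using ob[of C] C sub P.Idn_closed P.Comp_Idn_left unfolding isomorphic_def by blast
  then have "Phi_op \<C> C \<in> Phi_op_image \<C> \<X>" using C ob sub unfolding Phi_op_image_def by blast
  with P.right_approximation_isomorphic[OF F ob[OF M] _ C(2)] obtain g
    where "right_approximation ?P (Phi_op_image \<C> \<X>) (Phi_op \<C> M) (Phi_op \<C> C) g"
    using Phi_op_image_def by (metis (no_types, lifting) mem_Collect_eq subsetI)
  with C show thesis using that by blast
qed

text \<open>
  The lift \<open>u\<close> of a right approximation of \<open>\<Phi>\<^sup>o\<^sup>p(M)\<close> is a left approximation up to arrows killed by
  \<open>\<Phi>\<^sup>o\<^sup>p\<close>: \<open>\<Phi>\<^sup>o\<^sup>p(v)\<close> factors through \<open>\<Phi>\<^sup>o\<^sup>p(u)\<close> by a transformation that lifts to some \<open>w\<close>, and \<open>v\<close> and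
  \<open>w u\<close> then have the same class at \<open>D1\<close>, that is, \<open>v1 - w1 u1\<close> extends along \<open>m\<close>.
\<close>

lemma Phi_approximation_lift:
  assumes sub: "\<X> \<subseteq> Obj (maps \<C>)"
    and fin: "contravariantly_finite (fp_functors \<C>) (Phi_op_image \<C> \<X>)"
    and M: "(M1, M0, m) \<in> Obj (maps \<C>)"
  obtains C1 C0 c u1 u0 where "(C1, C0, c) \<in> \<X>"
    "(u1, u0) \<in> Arr (maps \<C>) (M1, M0, m) (C1, C0, c)"
    "\<And>D1 D0 d v1 v0. \<lbrakk>(D1, D0, d) \<in> \<X>; (v1, v0) \<in> Arr (maps \<C>) (M1, M0, m) (D1, D0, d)\<rbrakk> \<Longrightarrow>
      \<exists>w1 w0. \<exists>s \<in> Arr \<C> M0 D1. (w1, w0) \<in> Arr (maps \<C>) (C1, C0, c) (D1, D0, d) \<and>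
        v1 = Comp \<C> M1 M0 D1 s m \<otimes>\<^bsub>Mor \<C> M1 D1\<^esub> Comp \<C> M1 C1 D1 w1 u1"
proof -
  have o: "M1 \<in> Obj \<C>" "M0 \<in> Obj \<C>" "m \<in> Arr \<C> M1 M0"
    using M by (auto simp: maps_Obj)
  obtain C \<eta> where C: "C \<in> \<X>"
    and ap: "right_approximation (fp_functors \<C>) (Phi_op_image \<C> \<X>) (Phi_op \<C> (M1, M0, m)) (Phi_op \<C> C) \<eta>"
    using Phi_right_approximation_in_image[OF sub fin M] by blast
  obtain C1 C0 c where Ceq: "C = (C1, C0, c)" by (cases C)
  have Co: "(C1, C0, c) \<in> Obj (maps \<C>)" using C sub Ceq by blast
  then have oC: "C1 \<in> Obj \<C>" "C0 \<in> Obj \<C>" "c \<in> Arr \<C> C1 C0" by (auto simp: maps_Obj)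
  have "\<eta> \<in> nat_trans \<C> (Phi_op \<C> (C1, C0, c)) (Phi_op \<C> (M1, M0, m))"
    using ap by (simp add: right_approximation_def fp_functors_def Ceq)
  then obtain u1 u0 where u: "(u1, u0) \<in> Arr (maps \<C>) (M1, M0, m) (C1, C0, c)"
    and \<eta>u: "\<And>X h. \<lbrakk>X \<in> Obj \<C>; h \<in> Arr \<C> C1 X\<rbrakk> \<Longrightarrow> \<eta> X (precomp_image C1 C0 c X #>\<^bsub>Mor \<C> C1 X\<^esub> h)
       = precomp_image M1 M0 m X #>\<^bsub>Mor \<C> M1 X\<^esub> Comp \<C> M1 C1 X h u1"
    using Phi_full M Co by metis
  show thesis
  proof (rule that[OF C[unfolded Ceq] u])
    fix D1 D0 d v1 v0 assume D: "(D1, D0, d) \<in> \<X>"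
      and v: "(v1, v0) \<in> Arr (maps \<C>) (M1, M0, m) (D1, D0, d)"
    have Do: "(D1, D0, d) \<in> Obj (maps \<C>)" using D sub by blast
    then have oD: "D1 \<in> Obj \<C>" "D0 \<in> Obj \<C>" "d \<in> Arr \<C> D1 D0" by (auto simp: maps_Obj)
    obtain \<theta> where \<theta>: "\<theta> \<in> nat_trans \<C> (Phi_op \<C> (D1, D0, d)) (Phi_op \<C> (M1, M0, m))"
      and \<theta>v: "\<And>X h. \<lbrakk>X \<in> Obj \<C>; h \<in> Arr \<C> D1 X\<rbrakk> \<Longrightarrow> \<theta> X (precomp_image D1 D0 d X #>\<^bsub>Mor \<C> D1 X\<^esub> h)
       = precomp_image M1 M0 m X #>\<^bsub>Mor \<C> M1 X\<^esub> Comp \<C> M1 D1 X h v1"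
      using Phi_map[OF v M Do] by metis
    interpret P: preadditive "fp_functors \<C> :: (('o, 'a, 'a set) ab_functor, _) precat"
      by (rule preadditive_fp_functors)
    have PD: "Phi_op \<C> (D1, D0, d) \<in> Phi_op_image \<C> \<X>"
      using Phi_op_in_fp_functors[OF oD] P.Idn_closed P.Comp_Idn_left D
      unfolding Phi_op_image_def isomorphic_def by blast
    obtain \<sigma> where \<sigma>: "\<sigma> \<in> nat_trans \<C> (Phi_op \<C> (D1, D0, d)) (Phi_op \<C> (C1, C0, c))"
      and \<sigma>\<theta>: "Comp (fp_functors \<C>) (Phi_op \<C> (D1, D0, d)) (Phi_op \<C> (C1, C0, c)) (Phi_op \<C> (M1, M0, m)) \<eta> \<sigma> = \<theta>"
      using ap PD \<theta> unfolding right_approximation_def Ceq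
      by (metis (no_types, lifting) fp_functors_def partial_object.select_convs(1) precat.select_convs(2))
    obtain w1 w0 where w: "(w1, w0) \<in> Arr (maps \<C>) (C1, C0, c) (D1, D0, d)"
      and \<sigma>w: "\<And>X h. \<lbrakk>X \<in> Obj \<C>; h \<in> Arr \<C> D1 X\<rbrakk> \<Longrightarrow> \<sigma> X (precomp_image D1 D0 d X #>\<^bsub>Mor \<C> D1 X\<^esub> h)
       = precomp_image C1 C0 c X #>\<^bsub>Mor \<C> C1 X\<^esub> Comp \<C> C1 D1 X h w1"
      using Phi_full[OF \<sigma> Co Do] by metis
    let ?PM = "\<lambda>h. precomp_image M1 M0 m D1 #>\<^bsub>Mor \<C> M1 D1\<^esub> h"
    have a: "v1 \<in> Arr \<C> M1 D1" "v0 \<in> Arr \<C> M0 D0" "Comp \<C> M1 D1 D0 d v1 = Comp \<C> M1 M0 D0 v0 m"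
      "u1 \<in> Arr \<C> M1 C1" "u0 \<in> Arr \<C> M0 C0" "Comp \<C> M1 C1 C0 c u1 = Comp \<C> M1 M0 C0 u0 m"
      "w1 \<in> Arr \<C> C1 D1" "w0 \<in> Arr \<C> C0 D0" "Comp \<C> C1 D1 D0 d w1 = Comp \<C> C1 C0 D0 w0 c"
      using v u w by (auto simp: maps_Arr)
    let ?x = "precomp_image D1 D0 d D1 #>\<^bsub>Mor \<C> D1 D1\<^esub> Idn \<C> D1"
    have id: "Idn \<C> D1 \<in> Arr \<C> D1 D1" using Idn_closed oD by blast
    have "?PM v1 = \<theta> D1 ?x" using \<theta>v[OF oD(1) id] a o oD by (simp add: Comp_Idn_left)
    also have "\<dots> = \<eta> D1 (\<sigma> D1 ?x)"
      using oD id by (simp add: \<sigma>\<theta>[symmetric] fp_functors_def compose_def Phi_carrier)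
    also have "\<dots> = ?PM (Comp \<C> M1 C1 D1 w1 u1)"
      using \<sigma>w[OF oD(1) id] \<eta>u[OF oD(1)] a oC oD by (simp add: Comp_Idn_left)
    finally obtain s where s: "s \<in> Arr \<C> M0 D1"
      "v1 = Comp \<C> M1 M0 D1 s m \<otimes>\<^bsub>Mor \<C> M1 D1\<^esub> Comp \<C> M1 C1 D1 w1 u1"
      using Phi_coset_eq_iff[OF o oD(1)] a Comp_closed o oC oD by metis
    then show "\<exists>w1 w0. \<exists>s \<in> Arr \<C> M0 D1. (w1, w0) \<in> Arr (maps \<C>) (C1, C0, c) (D1, D0, d) \<and>
        v1 = Comp \<C> M1 M0 D1 s m \<otimes>\<^bsub>Mor \<C> M1 D1\<^esub> Comp \<C> M1 C1 D1 w1 u1"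
      using w by blast
  qed
qed

text \<open>
  An arrow killed by \<open>\<Phi>\<^sup>o\<^sup>p\<close> is \<open>(s m, d s)\<close>, which factors through the identity map of \<open>M0\<close>, up to
  some \<open>(0, t)\<close>.  Commutativity of the squares gives \<open>(v0 - x0) m = d s m\<close>, so
  \<open>t = v0 - x0 - d s\<close> satisfies \<open>t m = 0\<close>.
\<close>

lemma maps_Arr_difference:
  assumes M: "(M1, M0, m) \<in> Obj (maps \<C>)" and D: "(D1, D0, d) \<in> Obj (maps \<C>)"
    and v: "(v1, v0) \<in> Arr (maps \<C>) (M1, M0, m) (D1, D0, d)"
    and x: "(x1, x0) \<in> Arr (maps \<C>) (M1, M0, m) (D1, D0, d)"
    and s: "s \<in> Arr \<C> M0 D1" "v1 = Comp \<C> M1 M0 D1 s m \<otimes>\<^bsub>Mor \<C> M1 D1\<^esub> x1"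
  obtains t where "t \<in> Arr \<C> M0 D0" "Comp \<C> M1 M0 D0 t m = \<one>\<^bsub>Mor \<C> M1 D0\<^esub>"
    "v0 = x0 \<otimes>\<^bsub>Mor \<C> M0 D0\<^esub> Comp \<C> M0 D1 D0 d s \<otimes>\<^bsub>Mor \<C> M0 D0\<^esub> t"
proof -
  have o: "M1 \<in> Obj \<C>" "M0 \<in> Obj \<C>" "m \<in> Arr \<C> M1 M0" "D1 \<in> Obj \<C>" "D0 \<in> Obj \<C>" "d \<in> Arr \<C> D1 D0"
    using M D by (auto simp: maps_Obj)
  have a: "v1 \<in> Arr \<C> M1 D1" "v0 \<in> Arr \<C> M0 D0" "Comp \<C> M1 D1 D0 d v1 = Comp \<C> M1 M0 D0 v0 m"
    "x1 \<in> Arr \<C> M1 D1" "x0 \<in> Arr \<C> M0 D0" "Comp \<C> M1 D1 D0 d x1 = Comp \<C> M1 M0 D0 x0 m"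
    using v x by (auto simp: maps_Arr)
  interpret G: comm_group "Mor \<C> M0 D0" using Mor_group o by blast
  interpret G10: comm_group "Mor \<C> M1 D0" using Mor_group o by blast
  define ds where "ds = Comp \<C> M0 D1 D0 d s"
  define y where "y = x0 \<otimes>\<^bsub>Mor \<C> M0 D0\<^esub> ds"
  define t where "t = inv\<^bsub>Mor \<C> M0 D0\<^esub> y \<otimes>\<^bsub>Mor \<C> M0 D0\<^esub> v0"
  have ds: "ds \<in> Arr \<C> M0 D0" unfolding ds_def using s(1) o Comp_closed by auto
  have y: "y \<in> Arr \<C> M0 D0" unfolding y_def using ds a by simp
  have t: "t \<in> Arr \<C> M0 D0" unfolding t_def using y a by simp
  have vt: "v0 = y \<otimes>\<^bsub>Mor \<C> M0 D0\<^esub> t"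
    unfolding t_def using y a by (simp add: G.m_assoc[symmetric])
  have "Comp \<C> M1 M0 D0 v0 m = Comp \<C> M1 D1 D0 d (Comp \<C> M1 M0 D1 s m \<otimes>\<^bsub>Mor \<C> M1 D1\<^esub> x1)"
    using a(3) s(2) by simp
  also have "\<dots> = Comp \<C> M1 M0 D0 ds m \<otimes>\<^bsub>Mor \<C> M1 D0\<^esub> Comp \<C> M1 M0 D0 x0 m"
    unfolding ds_def using o s(1) a by (simp add: Comp_distr_right Comp_closed Comp_assoc)
  also have "\<dots> = Comp \<C> M1 M0 D0 y m"
    unfolding y_def using o a ds by (simp add: Comp_distr_left Comp_closed G10.m_comm)
  finally have yv: "Comp \<C> M1 M0 D0 y m = Comp \<C> M1 M0 D0 v0 m" by simp
  have ymc: "Comp \<C> M1 M0 D0 y m \<in> Arr \<C> M1 D0" "Comp \<C> M1 M0 D0 t m \<in> Arr \<C> M1 D0"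
    using y t o Comp_closed by auto
  have "Comp \<C> M1 M0 D0 y m = Comp \<C> M1 M0 D0 y m \<otimes>\<^bsub>Mor \<C> M1 D0\<^esub> Comp \<C> M1 M0 D0 t m"
    using yv y t o by (simp add: vt Comp_distr_left)
  then have "Comp \<C> M1 M0 D0 t m = \<one>\<^bsub>Mor \<C> M1 D0\<^esub>"
    using ymc G10.l_cancel_one' by blast
  then show thesis using that t vt unfolding y_def ds_def by blast
qed

text \<open>
  The arrow \<open>\<pi>\<close> is a weak cokernel: approximations ask for no uniqueness, so neither does the
  extension \<open>t'\<close>.
\<close>

theorem covariantly_finite_if_Phi_op_image_contravariantly_finite:
  assumes sums: "\<And>X Y. \<lbrakk>X \<in> Obj \<C>; Y \<in> Obj \<C>\<rbrakk> \<Longrightarrow> \<exists>Z. direct_sum \<C> X Y Z"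
    and coker: "\<And>X Y f. \<lbrakk>X \<in> Obj \<C>; Y \<in> Obj \<C>; f \<in> Arr \<C> X Y\<rbrakk> \<Longrightarrow>
      \<exists>Q \<in> Obj \<C>. \<exists>\<pi> \<in> Arr \<C> Y Q. Comp \<C> X Y Q \<pi> f = \<one>\<^bsub>Mor \<C> X Q\<^esub> \<and>
        (\<forall>D \<in> Obj \<C>. \<forall>t \<in> Arr \<C> Y D. Comp \<C> X Y D t f = \<one>\<^bsub>Mor \<C> X D\<^esub> \<longrightarrow>
          (\<exists>t' \<in> Arr \<C> Q D. Comp \<C> Y Q D t' \<pi> = t))"
    and sub: "\<X> \<subseteq> Obj (maps \<C>)"
    and closed: "\<And>X Y Z. \<lbrakk>direct_sum (maps \<C>) X Y Z; X \<in> \<X>; Y \<in> \<X>\<rbrakk> \<Longrightarrow> Z \<in> \<X>"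
    and Z: "Z \<in> Obj \<C>" "\<And>M. M \<in> Obj \<C> \<Longrightarrow> (Z, M, \<one>\<^bsub>Mor \<C> Z M\<^esub>) \<in> \<X>"
    and ids: "\<And>M. M \<in> Obj \<C> \<Longrightarrow> (M, M, Idn \<C> M) \<in> \<X>"
    and fin: "contravariantly_finite (fp_functors \<C>) (Phi_op_image \<C> \<X>)"
  shows "covariantly_finite (maps \<C>) \<X>"
  unfolding covariantly_finite_def
proof (intro conjI ballI sub)
  fix M assume M: "M \<in> Obj (maps \<C>)"
  interpret mp: preadditive "maps \<C>" by (rule preadditive_maps)
  note grp = Mor_group[THEN comm_group.axioms(2)]
  note mon = grp[THEN group.is_monoid]
  obtain M1 M0 m where Meq: "M = (M1, M0, m)" by (cases M)
  have o: "M1 \<in> Obj \<C>" "M0 \<in> Obj \<C>" "m \<in> Arr \<C> M1 M0"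
    using M by (auto simp: Meq maps_Obj)
  obtain C1 C0 c u1 u0 where C: "(C1, C0, c) \<in> \<X>"
    and u: "(u1, u0) \<in> Arr (maps \<C>) M (C1, C0, c)"
    and lift: "\<And>D1 D0 d v1 v0. \<lbrakk>(D1, D0, d) \<in> \<X>; (v1, v0) \<in> Arr (maps \<C>) M (D1, D0, d)\<rbrakk> \<Longrightarrow>
      \<exists>w1 w0. \<exists>s \<in> Arr \<C> M0 D1. (w1, w0) \<in> Arr (maps \<C>) (C1, C0, c) (D1, D0, d) \<and>
        v1 = Comp \<C> M1 M0 D1 s m \<otimes>\<^bsub>Mor \<C> M1 D1\<^esub> Comp \<C> M1 C1 D1 w1 u1"
    using Phi_approximation_lift[OF sub fin M[unfolded Meq]] unfolding Meq by blast
  let ?C = "(C1, C0, c)"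
  have Cob: "?C \<in> Obj (maps \<C>)" using C sub by blast
  obtain Q \<pi> where Q: "Q \<in> Obj \<C>" "\<pi> \<in> Arr \<C> M0 Q" "Comp \<C> M1 M0 Q \<pi> m = \<one>\<^bsub>Mor \<C> M1 Q\<^esub>"
    and ext: "\<And>D t. \<lbrakk>D \<in> Obj \<C>; t \<in> Arr \<C> M0 D; Comp \<C> M1 M0 D t m = \<one>\<^bsub>Mor \<C> M1 D\<^esub>\<rbrakk> \<Longrightarrow>
          \<exists>t' \<in> Arr \<C> Q D. Comp \<C> M0 Q D t' \<pi> = t"
    using coker[OF o] by blast
  let ?I = "(M0, M0, Idn \<C> M0)" and ?Q = "(Z, Q, \<one>\<^bsub>Mor \<C> Z Q\<^esub>)"
  have I: "?I \<in> \<X>" "?I \<in> Obj (maps \<C>)" and Qm: "?Q \<in> \<X>" "?Q \<in> Obj (maps \<C>)"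
    using ids Z Q o sub by blast+
  have mI: "(m, Idn \<C> M0) \<in> Arr (maps \<C>) M ?I"
    using o by (simp add: Meq maps_Arr Idn_closed Comp_Idn_left)
  have pQ: "(\<one>\<^bsub>Mor \<C> M1 Z\<^esub>, \<pi>) \<in> Arr (maps \<C>) M ?Q"
    using o Q Z(1) mon by (simp add: Meq maps_Arr Comp_one_right monoid.one_closed)
  (* The approximation W is the sum of C, of the identity of M0, and of the map from Z to the
     cokernel Q; E is the sum of the first two. *)
  obtain E where E: "direct_sum (maps \<C>) ?C ?I E"
    using maps_direct_sum[OF sums Cob I(2)] by blast
  have EX: "E \<in> \<X>" "E \<in> Obj (maps \<C>)" using closed[OF E C I(1)] sub by auto
  obtain W where W: "direct_sum (maps \<C>) E ?Q W"
    using maps_direct_sum[OF sums EX(2) Qm(2)] by blast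
  have WX: "W \<in> \<X>" using closed[OF W EX(1) Qm(1)] .
  obtain e where e: "e \<in> Arr (maps \<C>) M E"
     and fe: "\<And>D \<alpha> \<beta>. \<lbrakk>D \<in> Obj (maps \<C>); \<alpha> \<in> Arr (maps \<C>) ?C D; \<beta> \<in> Arr (maps \<C>) ?I D\<rbrakk> \<Longrightarrow>
      \<exists>h \<in> Arr (maps \<C>) E D. Comp (maps \<C>) M E D h e
        = Comp (maps \<C>) M ?C D \<alpha> (u1, u0) \<otimes>\<^bsub>Mor (maps \<C>) M D\<^esub> Comp (maps \<C>) M ?I D \<beta> (m, Idn \<C> M0)"
    using mp.direct_sum_factor[OF E M u mI] by blast
  obtain w where w: "w \<in> Arr (maps \<C>) M W"
     and fw: "\<And>D \<alpha> \<beta>. \<lbrakk>D \<in> Obj (maps \<C>); \<alpha> \<in> Arr (maps \<C>) E D; \<beta> \<in> Arr (maps \<C>) ?Q D\<rbrakk> \<Longrightarrow>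
      \<exists>h \<in> Arr (maps \<C>) W D. Comp (maps \<C>) M W D h w
        = Comp (maps \<C>) M E D \<alpha> e \<otimes>\<^bsub>Mor (maps \<C>) M D\<^esub> Comp (maps \<C>) M ?Q D \<beta> (\<one>\<^bsub>Mor \<C> M1 Z\<^esub>, \<pi>)"
    using mp.direct_sum_factor[OF W M e pQ] by blast
  have "left_approximation (maps \<C>) \<X> M W w"
    unfolding left_approximation_def
  proof (intro conjI ballI WX w)
    fix D v assume D: "D \<in> \<X>" and v: "v \<in> Arr (maps \<C>) M D"
    obtain D1 D0 d where Deq: "D = (D1, D0, d)" by (cases D)
    have Dob: "D \<in> Obj (maps \<C>)" using D sub by blast
    obtain v1 v0 where veq: "v = (v1, v0)" by (cases v)
    have Do: "(D1, D0, d) \<in> Obj (maps \<C>)" using D sub Deq by blast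
    then have oD: "D1 \<in> Obj \<C>" "D0 \<in> Obj \<C>" "d \<in> Arr \<C> D1 D0" by (auto simp: maps_Obj)
    obtain w1 w0 s where w': "(w1, w0) \<in> Arr (maps \<C>) ?C D" and s: "s \<in> Arr \<C> M0 D1"
      "v1 = Comp \<C> M1 M0 D1 s m \<otimes>\<^bsub>Mor \<C> M1 D1\<^esub> Comp \<C> M1 C1 D1 w1 u1"
      using lift[of D1 D0 d v1 v0] D v unfolding Deq veq by blast
    let ?x1 = "Comp \<C> M1 C1 D1 w1 u1" and ?x0 = "Comp \<C> M0 C0 D0 w0 u0"
    let ?ds = "Comp \<C> M0 D1 D0 d s"
    have x: "(?x1, ?x0) \<in> Arr (maps \<C>) M D"
      using mp.Comp_closed[OF M Cob Dob u w'] by (simp add: Meq Deq maps_ops)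
    (* v = w u + (s m, d s) + (0, t): one term for each summand of W. *)
    obtain t where t: "t \<in> Arr \<C> M0 D0" "Comp \<C> M1 M0 D0 t m = \<one>\<^bsub>Mor \<C> M1 D0\<^esub>"
      and v0: "v0 = ?x0 \<otimes>\<^bsub>Mor \<C> M0 D0\<^esub> ?ds \<otimes>\<^bsub>Mor \<C> M0 D0\<^esub> t"
      using maps_Arr_difference[OF M[unfolded Meq] Do v[unfolded Meq Deq veq] x[unfolded Meq Deq] s] by blast
    obtain t' where t': "t' \<in> Arr \<C> Q D0" "Comp \<C> M0 Q D0 t' \<pi> = t"
      using ext[OF oD(2) t] by blast
    have s': "(s, ?ds) \<in> Arr (maps \<C>) ?I D"
      using s(1) o oD by (simp add: Deq maps_Arr Comp_closed Comp_Idn_right)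
    have t1: "(\<one>\<^bsub>Mor \<C> Z D1\<^esub>, t') \<in> Arr (maps \<C>) ?Q D"
      using t' Z(1) Q oD mon by (simp add: Deq maps_Arr Comp_one_right monoid.one_closed)
    obtain \<alpha> where \<alpha>: "\<alpha> \<in> Arr (maps \<C>) E D" and \<alpha>e: "Comp (maps \<C>) M E D \<alpha> e
        = Comp (maps \<C>) M ?C D (w1, w0) (u1, u0) \<otimes>\<^bsub>Mor (maps \<C>) M D\<^esub> Comp (maps \<C>) M ?I D (s, ?ds) (m, Idn \<C> M0)"
      using fe[OF Dob w' s'] by blast
    obtain h where h: "h \<in> Arr (maps \<C>) W D" and hw: "Comp (maps \<C>) M W D h w
        = Comp (maps \<C>) M E D \<alpha> e \<otimes>\<^bsub>Mor (maps \<C>) M D\<^esub> Comp (maps \<C>) M ?Q D (\<one>\<^bsub>Mor \<C> Z D1\<^esub>, t') (\<one>\<^bsub>Mor \<C> M1 Z\<^esub>, \<pi>)"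
      using fw[OF Dob \<alpha> t1] by blast
    have c1: "Comp \<C> M1 M0 D1 s m \<in> Arr \<C> M1 D1" "?x1 \<in> Arr \<C> M1 D1" "v1 \<in> Arr \<C> M1 D1"
      using s(1) x v o oD Comp_closed by (auto simp: Meq Deq veq maps_Arr)
    interpret G1: comm_group "Mor \<C> M1 D1" using Mor_group o oD by blast
    have v1: "v1 = ?x1 \<otimes>\<^bsub>Mor \<C> M1 D1\<^esub> Comp \<C> M1 M0 D1 s m"
      using s(2) c1 G1.m_comm by metis
    have "Comp \<C> M1 Z D1 \<one>\<^bsub>Mor \<C> Z D1\<^esub> \<one>\<^bsub>Mor \<C> M1 Z\<^esub> = \<one>\<^bsub>Mor \<C> M1 D1\<^esub>"
      using o oD Z(1) mon by (simp add: Comp_one_left monoid.one_closed)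
    moreover have "Comp \<C> M0 M0 D1 s (Idn \<C> M0) = s" "Comp \<C> M0 M0 D0 ?ds (Idn \<C> M0) = ?ds"
      using s(1) o oD by (simp_all add: Comp_Idn_right Comp_closed)
    ultimately have "Comp (maps \<C>) M W D h w = v"
      unfolding hw \<alpha>e unfolding Meq Deq veq maps_ops t'(2) using c1(3) v0
      by (simp add: v1[symmetric])
    then show "\<exists>h\<in>Arr (maps \<C>) W D. Comp (maps \<C>) M W D h w = v" using h by blast
  qed
  then show "\<exists>X f. left_approximation (maps \<C>) \<X> M X f" by blast
qed

end

section \<open>Direct sums and cokernels of finitely generated modules\<close>

text \<open>
  Submodules; closure under negatives is closure under multiplication by \<open>-1\<close>.
\<close>

definition submodule_closed :: "('a, 'c) ring_scheme \<Rightarrow> ('a, 'm, 'd) module_scheme \<Rightarrow> 'm set \<Rightarrow> bool" where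
  "submodule_closed R M H \<longleftrightarrow> H \<subseteq> carrier M \<and> \<zero>\<^bsub>M\<^esub> \<in> H \<and> (\<forall>x \<in> H. \<forall>y \<in> H. x \<oplus>\<^bsub>M\<^esub> y \<in> H) \<and>
     (\<forall>a \<in> carrier R. \<forall>x \<in> H. a \<odot>\<^bsub>M\<^esub> x \<in> H)"

lemma (in left_module) smult_l_null: "x \<in> carrier M \<Longrightarrow> \<zero> \<odot>\<^bsub>M\<^esub> x = \<zero>\<^bsub>M\<^esub>"
  using smult_l_distr[of \<zero> \<zero> x] by (simp add: M.add.l_cancel_one)

lemma (in left_module) smult_r_null: "a \<in> carrier R \<Longrightarrow> a \<odot>\<^bsub>M\<^esub> \<zero>\<^bsub>M\<^esub> = \<zero>\<^bsub>M\<^esub>"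
  using smult_r_distr[of a "\<zero>\<^bsub>M\<^esub>" "\<zero>\<^bsub>M\<^esub>"] by (simp add: M.add.l_cancel_one)

text \<open>
  A form of finite generation without sums, which passes to images and products by pulling
  submodules back.
\<close>

lemma (in left_module) fin_gen_iff_submodules:
  "fin_gen R M \<longleftrightarrow> (\<exists>S. finite S \<and> S \<subseteq> carrier M \<and>
     (\<forall>H. submodule_closed R M H \<and> S \<subseteq> H \<longrightarrow> H = carrier M))"
proof -
  have "(\<forall>x \<in> carrier M. \<exists>c \<in> S \<rightarrow> carrier R. x = (\<Oplus>\<^bsub>M\<^esub>s\<in>S. c s \<odot>\<^bsub>M\<^esub> s)) \<longleftrightarrow>
     (\<forall>H. submodule_closed R M H \<and> S \<subseteq> H \<longrightarrow> H = carrier M)" (is "?L \<longleftrightarrow> ?R")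
    if S: "finite S" "S \<subseteq> carrier M" for S
  proof
    assume L: ?L
    show ?R
    proof (intro allI impI)
      fix H assume H: "submodule_closed R M H \<and> S \<subseteq> H"
      have in_H: "(\<Oplus>\<^bsub>M\<^esub>s\<in>T. c s \<odot>\<^bsub>M\<^esub> s) \<in> H" if "finite T" "T \<subseteq> S" "c \<in> S \<rightarrow> carrier R" for T c
        using that
      proof (induction T rule: finite_induct)
        case empty then show ?case using H by (simp add: submodule_closed_def)
      next
        case (insert s T)
        then have "(\<lambda>s. c s \<odot>\<^bsub>M\<^esub> s) \<in> T \<rightarrow> carrier M" "s \<in> carrier M" "c s \<in> carrier R" "s \<in> H"
          using S H by auto
        then show ?case using insert H by (auto simp: submodule_closed_def M.finsum_insert)
      qed
      have "carrier M \<subseteq> H"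
      proof
        fix x assume "x \<in> carrier M"
        then obtain c where "c \<in> S \<rightarrow> carrier R" "x = (\<Oplus>\<^bsub>M\<^esub>s\<in>S. c s \<odot>\<^bsub>M\<^esub> s)" using L by blast
        then show "x \<in> H" using in_H[OF S(1) subset_refl] by blast
      qed
      then show "H = carrier M" using H by (auto simp: submodule_closed_def)
    qed
  next
    assume R: ?R
    define comb where "comb c = (\<Oplus>\<^bsub>M\<^esub>s\<in>S. c s \<odot>\<^bsub>M\<^esub> s)" for c
    have sm: "(\<lambda>s. c s \<odot>\<^bsub>M\<^esub> s) \<in> S \<rightarrow> carrier M" if "c \<in> S \<rightarrow> carrier R" for c
      using that S by auto
    have add: "comb c \<oplus>\<^bsub>M\<^esub> comb c' = comb (\<lambda>s. c s \<oplus> c' s)"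
      if "c \<in> S \<rightarrow> carrier R" "c' \<in> S \<rightarrow> carrier R" for c c'
      unfolding comb_def M.finsum_addf[OF sm[OF that(1)] sm[OF that(2)], symmetric]
      by (rule M.finsum_cong') (use that S in \<open>auto simp: smult_l_distr Pi_iff subset_iff\<close>)
    have mult: "a \<odot>\<^bsub>M\<^esub> (\<Oplus>\<^bsub>M\<^esub>s\<in>T. c s \<odot>\<^bsub>M\<^esub> s) = (\<Oplus>\<^bsub>M\<^esub>s\<in>T. (a \<otimes> c s) \<odot>\<^bsub>M\<^esub> s)"
      if "finite T" "T \<subseteq> S" "c \<in> S \<rightarrow> carrier R" "a \<in> carrier R" for T a c
      using that
    proof (induction T rule: finite_induct)
      case empty then show ?case by (simp add: smult_r_null)
    next
      case (insert s T)
      then have "(\<lambda>s. c s \<odot>\<^bsub>M\<^esub> s) \<in> T \<rightarrow> carrier M" "(\<lambda>s. (a \<otimes> c s) \<odot>\<^bsub>M\<^esub> s) \<in> T \<rightarrow> carrier M"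
        "s \<in> carrier M" "c s \<in> carrier R" using S by (auto simp: Pi_iff subset_iff)
      then show ?case using insert by (simp add: M.finsum_insert smult_r_distr smult_assoc)
    qed
    have delta: "comb (\<lambda>s. if t = s then \<one> else \<zero>) = t" if t: "t \<in> S" for t
    proof -
      have "comb (\<lambda>s. if t = s then \<one> else \<zero>) = (\<Oplus>\<^bsub>M\<^esub>s\<in>S. if t = s then s else \<zero>\<^bsub>M\<^esub>)"
        unfolding comb_def by (rule M.finsum_cong') (use S in \<open>auto simp: smult_l_null subset_iff\<close>)
      also have "\<dots> = t" using M.finsum_singleton[OF t S(1), of "\<lambda>s. s"] S by auto
      finally show ?thesis .
    qed
    let ?H = "comb ` (S \<rightarrow> carrier R)"
    have "comb (\<lambda>_. \<zero>) = \<zero>\<^bsub>M\<^esub>" unfolding comb_def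
      by (rule M.add.finprod_one_eqI) (use S in \<open>auto simp: smult_l_null\<close>)
    then have "\<zero>\<^bsub>M\<^esub> \<in> ?H" by (intro image_eqI[of _ _ "\<lambda>_. \<zero>"]) auto
    moreover have "x \<oplus>\<^bsub>M\<^esub> y \<in> ?H" if xy: "x \<in> ?H" "y \<in> ?H" for x y
    proof -
      obtain c c' where c: "c \<in> S \<rightarrow> carrier R" "x = comb c" "c' \<in> S \<rightarrow> carrier R" "y = comb c'"
        using xy by blast
      show ?thesis
        by (rule image_eqI[of _ _ "\<lambda>s. c s \<oplus> c' s"]) (use c add in \<open>auto simp: Pi_iff\<close>)
    qed
    moreover have "a \<odot>\<^bsub>M\<^esub> x \<in> ?H" if ax: "a \<in> carrier R" "x \<in> ?H" for a x
    proof -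
      obtain c where c: "c \<in> S \<rightarrow> carrier R" "x = comb c" using ax by blast
      show ?thesis
        by (rule image_eqI[of _ _ "\<lambda>s. a \<otimes> c s"])
          (use c ax mult[OF S(1) subset_refl c(1)] in \<open>auto simp: comb_def Pi_iff\<close>)
    qed
    moreover have "?H \<subseteq> carrier M" unfolding comb_def using M.finsum_closed sm by auto
    ultimately have "submodule_closed R M ?H" unfolding submodule_closed_def by blast
    moreover have "S \<subseteq> ?H"
    proof
      fix t assume "t \<in> S"
      then show "t \<in> ?H"
        by (intro image_eqI[of _ _ "\<lambda>s. if t = s then \<one> else \<zero>"]) (auto simp: delta)
    qed
    ultimately have "?H = carrier M" using R by blast
    then show ?L unfolding comb_def by blast
  qed
  then show ?thesis unfolding fin_gen_def
    by (intro arg_cong[where f = Ex] ext conj_cong refl)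
qed

lemma (in left_module) fin_gen_generatorsE:
  assumes "fin_gen R M"
  obtains S where "finite S" "S \<subseteq> carrier M"
    "\<forall>H. submodule_closed R M H \<and> S \<subseteq> H \<longrightarrow> H = carrier M"
  using iffD1[OF fin_gen_iff_submodules assms] by (elim exE conjE) (rule that)

lemma module_hom_zero:
  assumes "left_module R M" "left_module R N" "f \<in> module_hom R M N"
  shows "f \<zero>\<^bsub>M\<^esub> = \<zero>\<^bsub>N\<^esub>"
proof -
  interpret M: left_module R M by fact
  interpret N: left_module R N by fact
  note f = module_homD[OF assms(3)]
  show ?thesis using f(2)[of "\<zero>\<^bsub>M\<^esub>" "\<zero>\<^bsub>M\<^esub>"] f(1) by (simp add: N.M.add.l_cancel_one)
qed

lemma fin_gen_surjective_image:
  assumes M: "left_module R M" and N: "left_module R N" and h: "h \<in> module_hom R M N"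
    and surj: "h ` carrier M = carrier N" and fg: "fin_gen R M"
  shows "fin_gen R N"
proof -
  interpret M: left_module R M by fact
  interpret N: left_module R N by fact
  note hD = module_homD[OF h] and h0 = module_hom_zero[OF M N h]
  obtain S where S: "finite S" "S \<subseteq> carrier M"
    and gen: "\<forall>H. submodule_closed R M H \<and> S \<subseteq> H \<longrightarrow> H = carrier M"
    by (rule M.fin_gen_generatorsE[OF fg]) (rule that)
  have "H = carrier N" if H: "submodule_closed R N H" "h ` S \<subseteq> H" for H
  proof -
    have "submodule_closed R M {x \<in> carrier M. h x \<in> H}"
      using H(1) hD h0 by (auto simp: submodule_closed_def)
    from gen[rule_format, OF conjI[OF this]] have "carrier M \<subseteq> {x \<in> carrier M. h x \<in> H}" using H(2) S by blast
    then have "h ` carrier M \<subseteq> H" by blast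
    then show ?thesis using H(1) surj by (auto simp: submodule_closed_def)
  qed
  moreover have "h ` S \<subseteq> carrier N" using S surj by blast
  ultimately show ?thesis unfolding N.fin_gen_iff_submodules using S(1)
    by (intro exI[of _ "h ` S"]) blast
qed

lemma product_module:
  fixes M :: "('a, 'm) module" and N :: "('a, 'n) module"
  assumes M: "left_module R M" "fin_gen R M" and N: "left_module R N" "fin_gen R N"
  obtains P :: "('a, 'm \<times> 'n) module" where "left_module R P" "fin_gen R P"
    "carrier P = carrier M \<times> carrier N"
    "\<And>x y x' y'. (x, y) \<oplus>\<^bsub>P\<^esub> (x', y') = (x \<oplus>\<^bsub>M\<^esub> x', y \<oplus>\<^bsub>N\<^esub> y')"
    "\<And>a x y. a \<odot>\<^bsub>P\<^esub> (x, y) = (a \<odot>\<^bsub>M\<^esub> x, a \<odot>\<^bsub>N\<^esub> y)"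
proof -
  interpret M: left_module R M by fact
  interpret N: left_module R N by fact
  define P :: "('a, 'm \<times> 'n) module" where "P =
    \<lparr>carrier = carrier M \<times> carrier N, mult = undefined, one = undefined, zero = (\<zero>\<^bsub>M\<^esub>, \<zero>\<^bsub>N\<^esub>),
      add = (\<lambda>(x, y) (x', y'). (x \<oplus>\<^bsub>M\<^esub> x', y \<oplus>\<^bsub>N\<^esub> y')), smult = (\<lambda>a (x, y). (a \<odot>\<^bsub>M\<^esub> x, a \<odot>\<^bsub>N\<^esub> y))\<rparr>"
  have P: "carrier P = carrier M \<times> carrier N" "\<zero>\<^bsub>P\<^esub> = (\<zero>\<^bsub>M\<^esub>, \<zero>\<^bsub>N\<^esub>)"
    "\<And>x y x' y'. (x, y) \<oplus>\<^bsub>P\<^esub> (x', y') = (x \<oplus>\<^bsub>M\<^esub> x', y \<oplus>\<^bsub>N\<^esub> y')"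
    "\<And>a x y. a \<odot>\<^bsub>P\<^esub> (x, y) = (a \<odot>\<^bsub>M\<^esub> x, a \<odot>\<^bsub>N\<^esub> y)"
    by (simp_all add: P_def)
  have "abelian_group P"
  proof (rule abelian_groupI, goal_cases)
    case (6 x)
    then obtain u v where u: "u \<in> carrier M" "v \<in> carrier N" "x = (u, v)" by (auto simp: P)
    show ?case by (rule bexI[of _ "(\<ominus>\<^bsub>M\<^esub> u, \<ominus>\<^bsub>N\<^esub> v)"]) (use u in \<open>auto simp: P M.l_neg N.l_neg\<close>)
  qed (auto simp: P M.a_ac N.a_ac)
  then have mod: "left_module R P"
    by (intro left_module.intro left_module_axioms.intro M.R.ring_axioms)
      (auto simp: P M.smult_l_distr M.smult_r_distr M.smult_assoc N.smult_l_distr N.smult_r_distr N.smult_assoc)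
  interpret P: left_module R P by (rule mod)
  obtain S where S: "finite S" "S \<subseteq> carrier M"
    and genS: "\<forall>H. submodule_closed R M H \<and> S \<subseteq> H \<longrightarrow> H = carrier M"
    by (rule M.fin_gen_generatorsE[OF M(2)]) (rule that)
  obtain T where T: "finite T" "T \<subseteq> carrier N"
    and genT: "\<forall>H. submodule_closed R N H \<and> T \<subseteq> H \<longrightarrow> H = carrier N"
    by (rule N.fin_gen_generatorsE[OF N(2)]) (rule that)
  let ?U = "S \<times> {\<zero>\<^bsub>N\<^esub>} \<union> {\<zero>\<^bsub>M\<^esub>} \<times> T"
  have "H = carrier P" if H: "submodule_closed R P H" "?U \<subseteq> H" for H
  proof -
    have Hadd: "(x \<oplus>\<^bsub>M\<^esub> x', y \<oplus>\<^bsub>N\<^esub> y') \<in> H" if "(x, y) \<in> H" "(x', y') \<in> H" for x y x' y'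
      using H(1) that by (auto simp: submodule_closed_def P(3)[symmetric])
    have Hmul: "(a \<odot>\<^bsub>M\<^esub> x, a \<odot>\<^bsub>N\<^esub> y) \<in> H" if "a \<in> carrier R" "(x, y) \<in> H" for a x y
      using H(1) that by (auto simp: submodule_closed_def P(4)[symmetric])
    have H0: "(\<zero>\<^bsub>M\<^esub>, \<zero>\<^bsub>N\<^esub>) \<in> H" using H(1) by (simp add: submodule_closed_def P)
    have "submodule_closed R M {x \<in> carrier M. (x, \<zero>\<^bsub>N\<^esub>) \<in> H}"
      using H0 Hadd[of _ "\<zero>\<^bsub>N\<^esub>" _ "\<zero>\<^bsub>N\<^esub>"] Hmul[of _ _ "\<zero>\<^bsub>N\<^esub>"]
      by (auto simp: submodule_closed_def N.smult_r_null)
    note genS[rule_format, OF conjI[OF this]]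
    then have 1: "(x, \<zero>\<^bsub>N\<^esub>) \<in> H" if "x \<in> carrier M" for x using H(2) S that by blast
    have "submodule_closed R N {y \<in> carrier N. (\<zero>\<^bsub>M\<^esub>, y) \<in> H}"
      using H0 Hadd[of "\<zero>\<^bsub>M\<^esub>" _ "\<zero>\<^bsub>M\<^esub>"] Hmul[of _ "\<zero>\<^bsub>M\<^esub>"]
      by (auto simp: submodule_closed_def M.smult_r_null)
    note genT[rule_format, OF conjI[OF this]]
    then have 2: "(\<zero>\<^bsub>M\<^esub>, y) \<in> H" if "y \<in> carrier N" for y using H(2) T that by blast
    have "(x, y) \<in> H" if "x \<in> carrier M" "y \<in> carrier N" for x y
      using Hadd[OF 1 2] that by simp
    then show ?thesis using H(1) by (auto simp: submodule_closed_def P(1))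
  qed
  moreover have "finite ?U" "?U \<subseteq> carrier P" using S T by (auto simp: P(1))
  ultimately have "fin_gen R P" unfolding P.fin_gen_iff_submodules
    by (intro exI[of _ ?U]) blast
  with mod P show thesis using that by blast
qed

text \<open>
  The product lives on the type of pairs; the size assumption on \<open>'m\<close> brings it back to a module
  on \<open>'m\<close>.
\<close>

lemma fg_mod_direct_sum:
  fixes M N :: "('a, 'm) module" and \<iota> :: "'a list \<Rightarrow> 'm"
  assumes inj: "inj_on \<iota> (lists (carrier R))"
    and MN: "M \<in> Obj (fg_mod R)" "N \<in> Obj (fg_mod R)"
  shows "\<exists>Z. direct_sum (fg_mod R) M N Z"
proof -
  have MN': "left_module R M" "fin_gen R M" "left_module R N" "fin_gen R N"
    using MN by (auto simp: fg_mod_def)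
  interpret M: left_module R M by fact
  interpret N: left_module R N by fact
  obtain P :: "('a, 'm \<times> 'm) module" where P: "left_module R P" "fin_gen R P"
    and Pc: "carrier P = carrier M \<times> carrier N" 
    and Pa: "\<And>x y x' y'. (x, y) \<oplus>\<^bsub>P\<^esub> (x', y') = (x \<oplus>\<^bsub>M\<^esub> x', y \<oplus>\<^bsub>N\<^esub> y')"
    and Ps: "\<And>a x y. a \<odot>\<^bsub>P\<^esub> (x, y) = (a \<odot>\<^bsub>M\<^esub> x, a \<odot>\<^bsub>N\<^esub> y)"
    using product_module[OF MN'] by metis
  obtain Z :: "('a, 'm) module" and h where Z: "left_module R Z" "fin_gen R Z"
    and h: "h \<in> module_hom R P Z" and bij: "bij_betw h (carrier P) (carrier Z)"
    using fin_gen_module_representative[OF P inj] by blast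
  note hc = module_homD(1)[OF h, unfolded Pc] and ha = module_homD(2)[OF h, unfolded Pc, symmetric]
    and hs = module_homD(3)[OF h, unfolded Pc, symmetric]
  define k where "k = the_inv_into (carrier P) h"
  have kh: "k (h (x, y)) = (x, y)" if "x \<in> carrier M" "y \<in> carrier N" for x y
    unfolding k_def using bij that by (simp add: bij_betw_def the_inv_into_f_f Pc)
  have Zc: "carrier Z = h ` (carrier M \<times> carrier N)" using bij by (simp add: bij_betw_def Pc)
  define i where "i = (\<lambda>x\<in>carrier M. h (x, \<zero>\<^bsub>N\<^esub>))"
  define j where "j = (\<lambda>y\<in>carrier N. h (\<zero>\<^bsub>M\<^esub>, y))"
  define p where "p = (\<lambda>z\<in>carrier Z. fst (k z))"
  define q where "q = (\<lambda>z\<in>carrier Z. snd (k z))"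
  have ph: "p (h (x, y)) = x" and qh: "q (h (x, y)) = y" if "x \<in> carrier M" "y \<in> carrier N" for x y
    using that hc kh by (simp_all add: p_def q_def)
  have i: "i \<in> module_hom R M Z"
    by (rule module_homI) (auto simp: i_def hc ha hs Pa Ps N.smult_r_null)
  have j: "j \<in> module_hom R N Z"
    by (rule module_homI) (auto simp: j_def hc ha hs Pa Ps M.smult_r_null)
  have p: "p \<in> module_hom R Z M"
    by (rule module_homI) (auto simp: Zc ph ha hs Pa Ps, auto simp: p_def Zc)
  have q: "q \<in> module_hom R Z N"
    by (rule module_homI) (auto simp: Zc qh ha hs Pa Ps, auto simp: q_def Zc)
  have "direct_sum (fg_mod R) M N Z"
    unfolding direct_sum_def
  proof (intro conjI bexI)
    show "i \<in> Arr (fg_mod R) M Z" "j \<in> Arr (fg_mod R) N Z" "p \<in> Arr (fg_mod R) Z M" "q \<in> Arr (fg_mod R) Z N"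
      using i j p q by (simp_all add: fg_mod_def)
    show "Z \<in> Obj (fg_mod R)" using Z by (simp add: fg_mod_def)
    show "Comp (fg_mod R) M Z M p i = Idn (fg_mod R) M" "Comp (fg_mod R) N Z N q j = Idn (fg_mod R) N"
      by (auto simp: fg_mod_def compose_def i_def j_def p_def q_def hc kh intro!: restrict_ext)
    show "Comp (fg_mod R) Z M Z i p \<otimes>\<^bsub>Mor (fg_mod R) Z Z\<^esub> Comp (fg_mod R) Z N Z j q = Idn (fg_mod R) Z"
      by (auto simp: fg_mod_def compose_def i_def j_def p_def q_def Zc kh ha Pa intro!: restrict_ext)
  qed (use MN in auto)
  then show ?thesis by blast
qed

lemma fg_mod_zero:
  fixes R :: "('a, 'c) ring_scheme"
  assumes "ring R"
  obtains Z :: "('a, 'm) module" where "Z \<in> Obj (fg_mod R)" "carrier Z = {\<zero>\<^bsub>Z\<^esub>}"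
proof -
  interpret R: ring R by fact
  define Z :: "('a, 'm) module" where "Z = \<lparr>carrier = {undefined}, mult = undefined, one = undefined,
     zero = undefined, add = (\<lambda>_ _. undefined), smult = (\<lambda>_ _. undefined)\<rparr>"
  have "abelian_group Z" by (rule abelian_groupI) (auto simp: Z_def)
  then have mod: "left_module R Z"
    by (intro left_module.intro left_module_axioms.intro R.ring_axioms) (auto simp: Z_def)
  interpret Z: left_module R Z by (rule mod)
  have Z: "carrier Z = {\<zero>\<^bsub>Z\<^esub>}" by (simp add: Z_def)
  have "fin_gen R Z" unfolding fin_gen_def by (rule exI[of _ "{}"]) (simp add: Z)
  with mod have "Z \<in> Obj (fg_mod R)" by (simp add: fg_mod_def)
  then show thesis using Z by (rule that)
qed

text \<open>
  The quotient of \<open>M\<close> by the kernel relation of \<open>r\<close>, realised on the values of \<open>r\<close>.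
\<close>

lemma quotient_module_on_representatives:
  fixes M :: "('a, 'm) module" and r :: "'m \<Rightarrow> 'n"
  assumes M: "left_module R M"
    and add: "\<And>x x' y y'. \<lbrakk>x \<in> carrier M; x' \<in> carrier M; y \<in> carrier M; y' \<in> carrier M; r x = r x'; r y = r y'\<rbrakk>
      \<Longrightarrow> r (x \<oplus>\<^bsub>M\<^esub> y) = r (x' \<oplus>\<^bsub>M\<^esub> y')"
    and smult: "\<And>a x x'. \<lbrakk>a \<in> carrier R; x \<in> carrier M; x' \<in> carrier M; r x = r x'\<rbrakk>
      \<Longrightarrow> r (a \<odot>\<^bsub>M\<^esub> x) = r (a \<odot>\<^bsub>M\<^esub> x')"
  obtains N :: "('a, 'n) module" where "left_module R N" "carrier N = r ` carrier M"
    "restrict r (carrier M) \<in> module_hom R M N"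
proof -
  interpret M: left_module R M by fact
  define g where "g = inv_into (carrier M) r"
  define N :: "('a, 'n) module" where "N =
    \<lparr>carrier = r ` carrier M, mult = undefined, one = undefined, zero = r \<zero>\<^bsub>M\<^esub>,
      add = (\<lambda>x y. r (g x \<oplus>\<^bsub>M\<^esub> g y)), smult = (\<lambda>a x. r (a \<odot>\<^bsub>M\<^esub> g x))\<rparr>"
  have g: "g (r x) \<in> carrier M" "r (g (r x)) = r x" if "x \<in> carrier M" for x
    using that by (auto simp: g_def inv_into_into f_inv_into_f)
  have N: "carrier N = r ` carrier M" "\<zero>\<^bsub>N\<^esub> = r \<zero>\<^bsub>M\<^esub>" by (auto simp: N_def)
  have Na: "r x \<oplus>\<^bsub>N\<^esub> r y = r (x \<oplus>\<^bsub>M\<^esub> y)" if "x \<in> carrier M" "y \<in> carrier M" for x y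
  proof -
    have "r x \<oplus>\<^bsub>N\<^esub> r y = r (g (r x) \<oplus>\<^bsub>M\<^esub> g (r y))" by (simp add: N_def)
    also have "\<dots> = r (x \<oplus>\<^bsub>M\<^esub> y)" by (rule add) (use that g in auto)
    finally show ?thesis .
  qed
  have Ns: "a \<odot>\<^bsub>N\<^esub> r x = r (a \<odot>\<^bsub>M\<^esub> x)" if "a \<in> carrier R" "x \<in> carrier M" for a x
  proof -
    have "a \<odot>\<^bsub>N\<^esub> r x = r (a \<odot>\<^bsub>M\<^esub> g (r x))" by (simp add: N_def)
    also have "\<dots> = r (a \<odot>\<^bsub>M\<^esub> x)" by (rule smult) (use that g in auto)
    finally show ?thesis .
  qed
  have "abelian_group N"
  proof (rule abelian_groupI, goal_cases)
    case (6 x)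
    then obtain u where u: "u \<in> carrier M" "x = r u" by (auto simp: N)
    show ?case by (rule bexI[of _ "r (\<ominus>\<^bsub>M\<^esub> u)"]) (use u in \<open>auto simp: N Na M.l_neg\<close>)
  qed (auto simp: N Na M.a_ac)
  then have "left_module R N"
    by (intro left_module.intro left_module_axioms.intro M.R.ring_axioms)
      (auto simp: N Na Ns M.smult_l_distr M.smult_r_distr M.smult_assoc)
  moreover have "restrict r (carrier M) \<in> module_hom R M N"
    by (rule module_homI) (auto simp: N Na Ns)
  ultimately show thesis using that N by blast
qed

text \<open>
  The cokernel is realised on a set of representatives of the cosets of the image of \<open>f\<close>, so that
  its carrier is again a subset of \<open>'m\<close>, and the map induced on it by \<open>t\<close> is a restriction of \<open>t\<close>.
\<close>

lemma fg_mod_cokernel: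
  fixes M N :: "('a, 'm) module"
  assumes MN: "M \<in> Obj (fg_mod R)" "N \<in> Obj (fg_mod R)" and f: "f \<in> Arr (fg_mod R) M N"
  shows "\<exists>Q \<in> Obj (fg_mod R). \<exists>\<pi> \<in> Arr (fg_mod R) N Q.
    Comp (fg_mod R) M N Q \<pi> f = \<one>\<^bsub>Mor (fg_mod R) M Q\<^esub> \<and>
    (\<forall>D \<in> Obj (fg_mod R). \<forall>t \<in> Arr (fg_mod R) N D. Comp (fg_mod R) M N D t f = \<one>\<^bsub>Mor (fg_mod R) M D\<^esub> \<longrightarrow>
      (\<exists>t' \<in> Arr (fg_mod R) Q D. Comp (fg_mod R) N Q D t' \<pi> = t))"
proof -
  have MN': "left_module R M" "fin_gen R M" "left_module R N" "fin_gen R N"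
    using MN by (auto simp: fg_mod_def)
  interpret M: left_module R M by fact
  interpret N: left_module R N by fact
  have f: "f \<in> module_hom R M N" using f by (simp add: fg_mod_def)
  note fD = module_homD[OF f] and f0 = module_hom_zero[OF MN'(1,3) f]
  (* E is congruence modulo the image of f, and r picks a representative of each class. *)
  define E where "E x y \<longleftrightarrow> (\<exists>z \<in> carrier M. x = f z \<oplus>\<^bsub>N\<^esub> y)" for x y
  have E_refl: "E x x" if "x \<in> carrier N" for x
    unfolding E_def using that f0 by (intro bexI[of _ "\<zero>\<^bsub>M\<^esub>"]) auto
  have E_sym: "E y x" if xy: "E x y" "y \<in> carrier N" for x y
  proof -
    obtain z where z: "z \<in> carrier M" "x = f z \<oplus>\<^bsub>N\<^esub> y" using xy by (auto simp: E_def)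
    have "f (\<ominus>\<^bsub>M\<^esub> z) \<oplus>\<^bsub>N\<^esub> f z = \<zero>\<^bsub>N\<^esub>" using z f0 fD(2)[of "\<ominus>\<^bsub>M\<^esub> z" z] by (simp add: M.l_neg)
    then have "y = f (\<ominus>\<^bsub>M\<^esub> z) \<oplus>\<^bsub>N\<^esub> x"
      using z that fD by (simp add: N.M.a_assoc[symmetric])
    then show ?thesis unfolding E_def using z by blast
  qed
  have E_trans: "E x w" if xyw: "E x y" "E y w" "w \<in> carrier N" for x y w
  proof -
    obtain z z' where "z \<in> carrier M" "x = f z \<oplus>\<^bsub>N\<^esub> y" "z' \<in> carrier M" "y = f z' \<oplus>\<^bsub>N\<^esub> w"
      using xyw by (auto simp: E_def)
    then show ?thesis unfolding E_def using that fD
      by (intro bexI[of _ "z \<oplus>\<^bsub>M\<^esub> z'"]) (auto simp: N.M.a_assoc)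
  qed
  define r where "r x = (SOME y. y \<in> carrier N \<and> E x y)" for x
  have r: "r x \<in> carrier N" "E x (r x)" if "x \<in> carrier N" for x
    using someI[of "\<lambda>y. y \<in> carrier N \<and> E x y" x] E_refl[OF that] that unfolding r_def by auto
  have r_eq: "r x = r y \<longleftrightarrow> E x y" if xy: "x \<in> carrier N" "y \<in> carrier N" for x y
  proof
    assume "r x = r y" then show "E x y" using r xy E_sym E_trans by metis
  next
    assume "E x y"
    then have "(\<lambda>w. w \<in> carrier N \<and> E x w) = (\<lambda>w. w \<in> carrier N \<and> E y w)"
      using E_sym E_trans xy by metis
    then show "r x = r y" unfolding r_def by simp
  qed
  have E_add: "E (x \<oplus>\<^bsub>N\<^esub> y) (x' \<oplus>\<^bsub>N\<^esub> y')"
    if xy: "E x x'" "E y y'" "x' \<in> carrier N" "y' \<in> carrier N" for x x' y y'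
  proof -
    obtain z z' where "z \<in> carrier M" "x = f z \<oplus>\<^bsub>N\<^esub> x'" "z' \<in> carrier M" "y = f z' \<oplus>\<^bsub>N\<^esub> y'"
      using xy by (auto simp: E_def)
    then show ?thesis unfolding E_def using that fD
      by (intro bexI[of _ "z \<oplus>\<^bsub>M\<^esub> z'"]) (auto simp: N.M.a_ac)
  qed
  have E_smult: "E (a \<odot>\<^bsub>N\<^esub> x) (a \<odot>\<^bsub>N\<^esub> x')" if "E x x'" "a \<in> carrier R" "x' \<in> carrier N" for a x x'
    using that fD N.smult_r_distr unfolding E_def by (metis M.smult_closed)
  obtain Q :: "('a, 'm) module" where Q: "left_module R Q" "carrier Q = r ` carrier N"
    and \<pi>: "restrict r (carrier N) \<in> module_hom R N Q"
  proof (rule quotient_module_on_representatives[OF MN'(3), of r])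
    show "r (x \<oplus>\<^bsub>N\<^esub> y) = r (x' \<oplus>\<^bsub>N\<^esub> y')"
      if "x \<in> carrier N" "x' \<in> carrier N" "y \<in> carrier N" "y' \<in> carrier N" "r x = r x'" "r y = r y'" for x x' y y'
      using that r_eq E_add by simp
    show "r (a \<odot>\<^bsub>N\<^esub> x) = r (a \<odot>\<^bsub>N\<^esub> x')"
      if "a \<in> carrier R" "x \<in> carrier N" "x' \<in> carrier N" "r x = r x'" for a x x'
      using that r_eq E_smult by simp
  qed blast
  define \<pi> where "\<pi> = restrict r (carrier N)"
  have \<pi>_hom: "\<pi> \<in> module_hom R N Q" using \<pi> by (simp add: \<pi>_def)
  note \<pi>D = module_homD[OF \<pi>_hom]
  have fgQ: "fin_gen R Q"
    by (rule fin_gen_surjective_image[OF MN'(3) Q(1) \<pi>_hom _ MN'(4)]) (simp add: Q \<pi>_def)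
  have "\<pi> (f z) = \<zero>\<^bsub>Q\<^esub>" if "z \<in> carrier M" for z
  proof -
    have "E (f z) \<zero>\<^bsub>N\<^esub>" unfolding E_def using that fD by auto
    then have "\<pi> (f z) = \<pi> \<zero>\<^bsub>N\<^esub>" using r_eq that fD by (simp add: \<pi>_def)
    then show ?thesis using module_hom_zero[OF MN'(3) Q(1) \<pi>_hom] by simp
  qed
  then have "compose (carrier M) \<pi> f = (\<lambda>x\<in>carrier M. \<zero>\<^bsub>Q\<^esub>)"
    by (auto simp: compose_def intro!: restrict_ext)
  moreover have "\<exists>t' \<in> module_hom R Q D. compose (carrier N) t' \<pi> = t"
    if D: "left_module R D" and t: "t \<in> module_hom R N D" "compose (carrier M) t f = (\<lambda>x\<in>carrier M. \<zero>\<^bsub>D\<^esub>)"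
    for D :: "('a, 'm) module" and t
  proof -
    interpret D: left_module R D by fact
    note tD = module_homD[OF t(1)]
    have tf: "t (f z) = \<zero>\<^bsub>D\<^esub>" if "z \<in> carrier M" for z
      using fun_cong[OF t(2), of z] that by (simp add: compose_def)
    have tr: "t (r x) = t x" if x: "x \<in> carrier N" for x
    proof -
      obtain z where "z \<in> carrier M" "x = f z \<oplus>\<^bsub>N\<^esub> r x" using r(2)[OF x] by (auto simp: E_def)
      then have "t x = \<zero>\<^bsub>D\<^esub> \<oplus>\<^bsub>D\<^esub> t (r x)" using tD(2)[of "f z" "r x"] tf fD(1) r(1)[OF x] by simp
      then show ?thesis using tD(1) r(1)[OF x] by simp
    qed
    have Qa: "r x \<oplus>\<^bsub>Q\<^esub> r y = r (x \<oplus>\<^bsub>N\<^esub> y)" if "x \<in> carrier N" "y \<in> carrier N" for x y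
      using \<pi>D(2)[OF that] that by (simp add: \<pi>_def)
    have Qs: "a \<odot>\<^bsub>Q\<^esub> r x = r (a \<odot>\<^bsub>N\<^esub> x)" if "a \<in> carrier R" "x \<in> carrier N" for a x
      using \<pi>D(3)[OF that] that by (simp add: \<pi>_def)
    define t' where "t' = restrict t (carrier Q)"
    have t'r: "t' (r x) = t x" if "x \<in> carrier N" for x
      using that tr by (simp add: t'_def Q)
    have "t' \<in> module_hom R Q D"
      by (rule module_homI) (auto simp: Q Qa Qs t'r tD, auto simp: t'_def Q)
    moreover have "compose (carrier N) t' \<pi> = t"
      using tD(4) by (auto simp: compose_def \<pi>_def t'r fun_eq_iff)
    ultimately show ?thesis by blast
  qed
  ultimately have "Q \<in> Obj (fg_mod R) \<and> \<pi> \<in> Arr (fg_mod R) N Q \<and>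
    Comp (fg_mod R) M N Q \<pi> f = \<one>\<^bsub>Mor (fg_mod R) M Q\<^esub> \<and>
    (\<forall>D \<in> Obj (fg_mod R). \<forall>t \<in> Arr (fg_mod R) N D. Comp (fg_mod R) M N D t f = \<one>\<^bsub>Mor (fg_mod R) M D\<^esub> \<longrightarrow>
      (\<exists>t' \<in> Arr (fg_mod R) Q D. Comp (fg_mod R) N Q D t' \<pi> = t))"
    using Q(1) fgQ \<pi>_hom by (simp add: fg_mod_def)
  then show ?thesis by blast
qed

section \<open>The theorem for artin algebras\<close>

theorem theorem3p10:
  fixes k :: "('k, 'c) ring_scheme" and \<phi> :: "'k \<Rightarrow> 'a" and \<Lambda> :: "('a, 'd) ring_scheme"
    and \<C> :: "(('a, 'm) module \<times> ('a, 'm) module \<times> ('m \<Rightarrow> 'm)) set"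
  assumes "artin_algebra k \<phi> \<Lambda>"
    and universe: "\<exists>\<iota> :: 'a list \<Rightarrow> 'm. inj_on \<iota> (lists (carrier \<Lambda>))"
    and "additive_subcategory (maps (fg_mod \<Lambda>)) \<C>"
    and "\<And>Z M. Z \<in> Obj (fg_mod \<Lambda>) \<Longrightarrow> carrier Z = {\<zero>\<^bsub>Z\<^esub>} \<Longrightarrow> M \<in> Obj (fg_mod \<Lambda>)
           \<Longrightarrow> (Z, M, \<lambda>x \<in> carrier Z. \<zero>\<^bsub>M\<^esub>) \<in> \<C>"
    and "\<And>M. M \<in> Obj (fg_mod \<Lambda>) \<Longrightarrow> (M, M, \<lambda>x \<in> carrier M. x) \<in> \<C>"
    and "contravariantly_finite (fp_functors (fg_mod \<Lambda>)) (Phi_op_image (fg_mod \<Lambda>) \<C>)"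
  shows "covariantly_finite (maps (fg_mod \<Lambda>)) \<C>"
proof -
  let ?F = "fg_mod \<Lambda> :: (('a, 'm) module, 'm \<Rightarrow> 'm) precat"
  interpret preadditive ?F by (rule preadditive_fg_mod)
  note sub = \<open>additive_subcategory (maps (fg_mod \<Lambda>)) \<C>\<close>[unfolded additive_subcategory_def]
  obtain \<iota> :: "'a list \<Rightarrow> 'm" where \<iota>: "inj_on \<iota> (lists (carrier \<Lambda>))" using universe by blast
  have "ring \<Lambda>" using assms(1) by (simp add: artin_algebra_def)
  then obtain Z :: "('a, 'm) module" where Z: "Z \<in> Obj ?F" "carrier Z = {\<zero>\<^bsub>Z\<^esub>}"
    by (rule fg_mod_zero)
  show ?thesis
  proof (rule covariantly_finite_if_Phi_op_image_contravariantly_finite)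
    show "\<exists>Z. direct_sum ?F X Y Z" if "X \<in> Obj ?F" "Y \<in> Obj ?F" for X Y
      using fg_mod_direct_sum[OF \<iota> that] .
    show "Z \<in> Obj ?F" by (rule Z(1))
    show "(Z, M, \<one>\<^bsub>Mor ?F Z M\<^esub>) \<in> \<C>" if "M \<in> Obj ?F" for M
      using assms(4)[OF Z that] by (simp add: fg_mod_def)
    show "(M, M, Idn ?F M) \<in> \<C>" if "M \<in> Obj ?F" for M
      using assms(5)[OF that] by (simp add: fg_mod_def)
    show "\<C> \<subseteq> Obj (maps ?F)" using sub by blast
    show "W \<in> \<C>" if "direct_sum (maps ?F) X Y W" "X \<in> \<C>" "Y \<in> \<C>" for X Y W
      using sub that by blast
  qed (fact fg_mod_cokernel, fact assms(6))
qed

end
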